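(* Let $\mathcal{H}$ be a Hopf algebra with bijective antipode over a field $k$ of characteristic zero, let $A$ be a Yetter-Drinfeld $\mathcal{H}$-algebra, and let $V$ be a finite dimensional $\mathcal{H}$-module. For $n\ge0$ and $f\in C^n_{\mathcal{H}}(A)$ put $$\Psi^nf(a_0\otimes u_0,\dots,a_n\otimes u_n)(g)=f(a_{0<0>},a_{1<0>},\dots,a_{n<0>})(g^{(1)})\;\mathrm{tr}\bigl(S(a_{0<1>})u_0S(a_{1<1>})u_1\cdots S(a_{n<1>})u_n\,g^{(0)}\bigr)$$ for $a_i\in A$, $u_i\in\mathrm{End}(V)$, $g\in\mathcal{H}$. Then $\Psi^n$ maps equivariant cochains to equivariant cochains, i.e. $\Psi^n: C^n_{\mathcal{H}}(A)\to C^n_{\mathcal{H}}(A\otimes\mathrm{End}(V))$, and $\Psi=\{\Psi^n\}_{n\ge0}$ is a morphism of cocyclic modules (it commutes with all coface, codegeneracy and cyclic operators).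
   Context: Sweedler notation: $\Delta h=h^{(0)}\otimes h^{(1)}$, $\Delta^{(n)}h=h^{(0)}\otimes\cdots\otimes h^{(n)}$; $S,\epsilon$ are antipode and counit. Algebras are unital. A left $\mathcal{H}$-algebra is an algebra $A$ that is a left $\mathcal{H}$-module with $h\cdot(ab)=(h^{(0)}\cdot a)(h^{(1)}\cdot b)$, $h\cdot1=\epsilon(h)1$. A Yetter-Drinfeld $\mathcal{H}$-algebra is an algebra $A$ that is (1) a left $\mathcal{H}$-algebra; (2) a right $\mathcal{H}^{op}$-comodule algebra, i.e. there is a right coaction $\rho:A\to A\otimes\mathcal{H}$, $\rho(a)=a_{<0>}\otimes a_{<1>}$, with $\rho(ab)=a_{<0>}b_{<0>}\otimes b_{<1>}a_{<1>}$ and $\rho(1)=1\otimes1$; (3) satisfying $(h^{(1)}\cdot a)_{<0>}\otimes(h^{(1)}\cdot a)_{<1>}h^{(0)}=h^{(0)}\cdot a_{<0>}\otimes h^{(1)}a_{<1>}$. Elements of $\mathcal{H}$ also denote the operators by which they act on $V$. $\mathcal{H}$ acts on $\mathrm{End}(V)$ by $h\cdot u=h^{(0)}\circ u\circ S(h^{(1)})$, and $A\otimes\mathrm{End}(V)$ is the $\mathcal{H}$-algebra with $(a\otimes u)(c\otimes v)=ac_{<0>}\otimes(c_{<1>}\cdot u)v$ and $h\cdot(a\otimes u)=h^{(0)}\cdot a\otimes h^{(1)}\cdot u$. For any $\mathcal{H}$-algebra $A$, let $F(\mathcal{H})=\mathrm{Hom}_k(\mathcal{H},k)$; $C^n_{\mathcal{H}}(A)$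 is the space of $(n+1)$-linear maps $f:A^{\otimes(n+1)}\to F(\mathcal{H})$ that are equivariant: $f(h^{(0)}\cdot a_0,\dots,h^{(n)}\cdot a_n)(g)=f(a_0,\dots,a_n)(S(h^{(1)})gh^{(0)})$ for all $h,g\in\mathcal{H}$, $a_i\in A$. It is a cocyclic module with coface maps $\partial^i:C^{n-1}_{\mathcal{H}}(A)\to C^n_{\mathcal{H}}(A)$, $\partial^i f(a_0,\dots,a_n)(g)=f(a_0,\dots,a_ia_{i+1},\dots,a_n)(g)$ for $0\le i\le n-1$, $\partial^n f(a_0,\dots,a_n)(g)=f((S^{-1}(g^{(0)})\cdot a_n)a_0,a_1,\dots,a_{n-1})(g^{(1)})$, codegeneracies $\sigma^i:C^{n+1}_{\mathcal{H}}(A)\to C^n_{\mathcal{H}}(A)$, $\sigma^i f(a_0,\dots,a_n)(g)=f(a_0,\dots,a_i,1,a_{i+1},\dots,a_n)(g)$ for $0\le i\le n$, and cyclic operators $T_nf(a_0,\dots,a_n)(g)=f(S^{-1}(g^{(0)})\cdot a_n,a_0,\dots,a_{n-1})(g^{(1)})$. *)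

theory Defs
  imports Complex_Main "HOL-Library.Function_Algebras"
begin

section \<open>Tensor products of vector spaces\<close>

text \<open>
  A list over a set \<open>G\<close> of generators stands for the formal sum of its entries. \<open>formal_eq G R\<close>
  is the least congruence on the commutative monoid of formal sums that contains the relations \<open>R\<close>.
\<close>

inductive formal_eq :: "'g set \<Rightarrow> ('g list \<times> 'g list) set \<Rightarrow> 'g list \<Rightarrow> 'g list \<Rightarrow> bool"
  for G :: "'g set" and R :: "('g list \<times> 'g list) set" where
  rel: "(xs, ys) \<in> R \<Longrightarrow> formal_eq G R xs ys"
| refl: "xs \<in> lists G \<Longrightarrow> formal_eq G R xs xs"
| sym: "formal_eq G R xs ys \<Longrightarrow> formal_eq G R ys xs"
| trans: "formal_eq G R xs ys \<Longrightarrow> formal_eq G R ys zs \<Longrightarrow> formal_eq G R xs zs"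
| add: "formal_eq G R xs xs' \<Longrightarrow> formal_eq G R ys ys' \<Longrightarrow> formal_eq G R (xs @ ys) (xs' @ ys')"
| comm: "xs \<in> lists G \<Longrightarrow> ys \<in> lists G \<Longrightarrow> formal_eq G R (xs @ ys) (ys @ xs)"

text \<open>
  The tensor product of the spaces \<open>X\<close> (scalar multiplication \<open>s\<close>) and \<open>Y\<close> (scalar multiplication
  \<open>t\<close>): formal sums of pairs modulo the bilinearity relations. The list \<open>[(x, y)]\<close> represents
  the pure tensor of \<open>x\<close> and \<open>y\<close>.
\<close>

definition tensor_rels ::
    "'a::ab_group_add set \<Rightarrow> ('k \<Rightarrow> 'a \<Rightarrow> 'a) \<Rightarrow> 'b::ab_group_add set \<Rightarrow> ('k \<Rightarrow> 'b \<Rightarrow> 'b)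
      \<Rightarrow> (('a \<times> 'b) list \<times> ('a \<times> 'b) list) set" where
  "tensor_rels X s Y t =
     {([(x + x', y)], [(x, y), (x', y)]) | x x' y. x \<in> X \<and> x' \<in> X \<and> y \<in> Y}
   \<union> {([(x, y + y')], [(x, y), (x, y')]) | x y y'. x \<in> X \<and> y \<in> Y \<and> y' \<in> Y}
   \<union> {([(s c x, y)], [(x, t c y)]) | c x y. x \<in> X \<and> y \<in> Y}
   \<union> {([(0, y)], []) | y. y \<in> Y}"

definition tensor_class ::
    "'a::ab_group_add set \<Rightarrow> ('k \<Rightarrow> 'a \<Rightarrow> 'a) \<Rightarrow> 'b::ab_group_add set \<Rightarrow> ('k \<Rightarrow> 'b \<Rightarrow> 'b)
      \<Rightarrow> ('a \<times> 'b) list \<Rightarrow> ('a \<times> 'b) list set" where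
  "tensor_class X s Y t xs = {ys. formal_eq (X \<times> Y) (tensor_rels X s Y t) xs ys}"

definition tensor_space ::
    "'a::ab_group_add set \<Rightarrow> ('k \<Rightarrow> 'a \<Rightarrow> 'a) \<Rightarrow> 'b::ab_group_add set \<Rightarrow> ('k \<Rightarrow> 'b \<Rightarrow> 'b)
      \<Rightarrow> ('a \<times> 'b) list set set" where
  "tensor_space X s Y t = tensor_class X s Y t ` lists (X \<times> Y)"

text \<open>
  A chosen way to write a tensor as a finite sum of pure tensors. A Sweedler expression is a sum over
  \<open>sw (\<Delta> h)\<close> or \<open>sw (\<rho> a)\<close>; it does not depend on the choice when its terms are bilinear.
\<close>

definition sw :: "'g list set \<Rightarrow> 'g list" where
  "sw t = (SOME xs. xs \<in> t)"

definition tensor_add ::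
    "'a::ab_group_add set \<Rightarrow> ('k \<Rightarrow> 'a \<Rightarrow> 'a) \<Rightarrow> 'b::ab_group_add set \<Rightarrow> ('k \<Rightarrow> 'b \<Rightarrow> 'b)
      \<Rightarrow> ('a \<times> 'b) list set \<Rightarrow> ('a \<times> 'b) list set \<Rightarrow> ('a \<times> 'b) list set" where
  "tensor_add X s Y t p q = tensor_class X s Y t (sw p @ sw q)"

definition tensor_scale ::
    "'a::ab_group_add set \<Rightarrow> ('k \<Rightarrow> 'a \<Rightarrow> 'a) \<Rightarrow> 'b::ab_group_add set \<Rightarrow> ('k \<Rightarrow> 'b \<Rightarrow> 'b)
      \<Rightarrow> 'k \<Rightarrow> ('a \<times> 'b) list set \<Rightarrow> ('a \<times> 'b) list set" where
  "tensor_scale X s Y t c p = tensor_class X s Y t [(s c x, y). (x, y) \<leftarrow> sw p]"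

definition linear_into_tensor ::
    "('k \<Rightarrow> 'c::ab_group_add \<Rightarrow> 'c) \<Rightarrow> ('k \<Rightarrow> 'a::ab_group_add \<Rightarrow> 'a) \<Rightarrow> ('k \<Rightarrow> 'b::ab_group_add \<Rightarrow> 'b)
      \<Rightarrow> ('c \<Rightarrow> ('a \<times> 'b) list set) \<Rightarrow> bool" where
  "linear_into_tensor r s t F \<longleftrightarrow>
     (\<forall>x. F x \<in> tensor_space UNIV s UNIV t) \<and>
     (\<forall>x y. F (x + y) = tensor_add UNIV s UNIV t (F x) (F y)) \<and>
     (\<forall>c x. F (r c x) = tensor_scale UNIV s UNIV t c (F x))"

text \<open>Equality in a threefold tensor product.\<close>

definition tensor3_rels ::
    "('k \<Rightarrow> 'a::ab_group_add \<Rightarrow> 'a) \<Rightarrow> ('k \<Rightarrow> 'b::ab_group_add \<Rightarrow> 'b) \<Rightarrow> ('k \<Rightarrow> 'c::ab_group_add \<Rightarrow> 'c)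
      \<Rightarrow> (('a \<times> 'b \<times> 'c) list \<times> ('a \<times> 'b \<times> 'c) list) set" where
  "tensor3_rels r s t =
     {([(x + x', y, z)], [(x, y, z), (x', y, z)]) | x x' y z. True}
   \<union> {([(x, y + y', z)], [(x, y, z), (x, y', z)]) | x y y' z. True}
   \<union> {([(x, y, z + z')], [(x, y, z), (x, y, z')]) | x y z z'. True}
   \<union> {([(r c x, y, z)], [(x, s c y, z)]) | c x y z. True}
   \<union> {([(x, s c y, z)], [(x, y, t c z)]) | c x y z. True}
   \<union> {([(0, y, z)], []) | y z. True}"

definition tensor3_eq ::
    "('k \<Rightarrow> 'a::ab_group_add \<Rightarrow> 'a) \<Rightarrow> ('k \<Rightarrow> 'b::ab_group_add \<Rightarrow> 'b) \<Rightarrow> ('k \<Rightarrow> 'c::ab_group_add \<Rightarrow> 'c)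
      \<Rightarrow> ('a \<times> 'b \<times> 'c) list \<Rightarrow> ('a \<times> 'b \<times> 'c) list \<Rightarrow> bool" where
  "tensor3_eq r s t = formal_eq UNIV (tensor3_rels r s t)"


section \<open>Hopf algebras, modules and Yetter-Drinfeld algebras\<close>

text \<open>The sort \<open>{ring, monoid_mult}\<close> is \<open>ring_1\<close> without \<open>0 \<noteq> 1\<close>, so the zero algebra is allowed.\<close>

locale unital_algebra = vector_space scale
  for scale :: "'k::field \<Rightarrow> 'a::{ring, monoid_mult} \<Rightarrow> 'a" +
  assumes scale_mult_left: "scale c x * y = scale c (x * y)"
    and scale_mult_right: "x * scale c y = scale c (x * y)"

record ('k, 'h) hopf_data =
  hscale :: "'k \<Rightarrow> 'h \<Rightarrow> 'h"
  comult :: "'h \<Rightarrow> ('h \<times> 'h) list set"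
  counit :: "'h \<Rightarrow> 'k"
  antipode :: "'h \<Rightarrow> 'h"

abbreviation sweedler :: "('k, 'h) hopf_data \<Rightarrow> 'h \<Rightarrow> ('h \<times> 'h) list" where
  "sweedler H h \<equiv> sw (comult H h)"

locale hopf_algebra =
  fixes H :: "('k::field, 'h::{ring, monoid_mult}) hopf_data"
  assumes algebra: "unital_algebra (hscale H)"
    and comult_linear: "linear_into_tensor (hscale H) (hscale H) (hscale H) (comult H)"
    and comult_mult: "comult H (g * h) =
          tensor_class UNIV (hscale H) UNIV (hscale H)
            [(g0 * h0, g1 * h1). (g0, g1) \<leftarrow> sweedler H g, (h0, h1) \<leftarrow> sweedler H h]"
    and comult_one: "comult H 1 = tensor_class UNIV (hscale H) UNIV (hscale H) [(1, 1)]"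
    and coassoc: "tensor3_eq (hscale H) (hscale H) (hscale H)
          [(x, y, h1). (h0, h1) \<leftarrow> sweedler H h, (x, y) \<leftarrow> sweedler H h0]
          [(h0, x, y). (h0, h1) \<leftarrow> sweedler H h, (x, y) \<leftarrow> sweedler H h1]"
    and counit_linear: "Vector_Spaces.linear (hscale H) (*) (counit H)"
    and counit_mult: "counit H (g * h) = counit H g * counit H h"
    and counit_one: "counit H 1 = 1"
    and counit_left: "(\<Sum>(h0, h1)\<leftarrow>sweedler H h. hscale H (counit H h0) h1) = h"
    and counit_right: "(\<Sum>(h0, h1)\<leftarrow>sweedler H h. hscale H (counit H h1) h0) = h"
    and antipode_linear: "Vector_Spaces.linear (hscale H) (hscale H) (antipode H)"
    and antipode_left: "(\<Sum>(h0, h1)\<leftarrow>sweedler H h. antipode H h0 * h1) = hscale H (counit H h) 1"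
    and antipode_right: "(\<Sum>(h0, h1)\<leftarrow>sweedler H h. h0 * antipode H h1) = hscale H (counit H h) 1"

locale hopf_module =
  fixes H :: "('k::field, 'h::{ring, monoid_mult}) hopf_data"
    and scale :: "'k \<Rightarrow> 'v::ab_group_add \<Rightarrow> 'v"
    and act :: "'h \<Rightarrow> 'v \<Rightarrow> 'v"
  assumes vector_space: "vector_space scale"
    and act_linear: "Vector_Spaces.linear scale scale (act h)"
    and act_add: "act (g + h) v = act g v + act h v"
    and act_scale: "act (hscale H c h) v = scale c (act h v)"
    and act_mult: "act (g * h) v = act g (act h v)"
    and act_one: "act 1 v = v"

locale hopf_module_algebra =
  hopf_module H scale act + unital_algebra scale
  for H :: "('k::field, 'h::{ring, monoid_mult}) hopf_data"
    and scale :: "'k \<Rightarrow> 'a::{ring, monoid_mult} \<Rightarrow> 'a"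
    and act :: "'h \<Rightarrow> 'a \<Rightarrow> 'a" +
  assumes act_prod: "act h (a * b) = (\<Sum>(h0, h1)\<leftarrow>sweedler H h. act h0 a * act h1 b)"
    and act_unit: "act h 1 = scale (counit H h) 1"

locale yetter_drinfeld_algebra =
  hopf_module_algebra H scale act
  for H :: "('k::field, 'h::{ring, monoid_mult}) hopf_data"
    and scale :: "'k \<Rightarrow> 'a::{ring, monoid_mult} \<Rightarrow> 'a"
    and act :: "'h \<Rightarrow> 'a \<Rightarrow> 'a" +
  fixes coact :: "'a \<Rightarrow> ('a \<times> 'h) list set"
  assumes coact_linear: "linear_into_tensor scale scale (hscale H) coact"
    and coact_coassoc: "tensor3_eq scale (hscale H) (hscale H)
          [(x, y, a1). (a0, a1) \<leftarrow> sw (coact a), (x, y) \<leftarrow> sw (coact a0)]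
          [(a0, x, y). (a0, a1) \<leftarrow> sw (coact a), (x, y) \<leftarrow> sweedler H a1]"
    and coact_counit: "(\<Sum>(a0, a1)\<leftarrow>sw (coact a). scale (counit H a1) a0) = a"
    and coact_mult: "coact (a * b) =
          tensor_class UNIV scale UNIV (hscale H)
            [(a0 * b0, b1 * a1). (a0, a1) \<leftarrow> sw (coact a), (b0, b1) \<leftarrow> sw (coact b)]"
    and coact_one: "coact 1 = tensor_class UNIV scale UNIV (hscale H) [(1, 1)]"
    and yetter_drinfeld:
      "tensor_class UNIV scale UNIV (hscale H)
         [(x0, x1 * h0). (h0, h1) \<leftarrow> sweedler H h, (x0, x1) \<leftarrow> sw (coact (act h1 a))] =
       tensor_class UNIV scale UNIV (hscale H)
         [(act h0 a0, h1 * a1). (h0, h1) \<leftarrow> sweedler H h, (a0, a1) \<leftarrow> sw (coact a)]"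


section \<open>Equivariant cochains\<close>

text \<open>
  Algebras with an action, given by a carrier and explicit operations. The carrier is needed since
  \<open>A \<otimes> End(V)\<close> is a set of equivalence classes which depends on the scalar multiplications.
\<close>

record ('k, 'h, 'x) act_alg =
  car :: "'x set"
  add :: "'x \<Rightarrow> 'x \<Rightarrow> 'x"
  smul :: "'k \<Rightarrow> 'x \<Rightarrow> 'x"
  mul :: "'x \<Rightarrow> 'x \<Rightarrow> 'x"
  unt :: "'x"
  act :: "'h \<Rightarrow> 'x \<Rightarrow> 'x"

definition type_alg ::
    "('k \<Rightarrow> 'a::{ring, monoid_mult} \<Rightarrow> 'a) \<Rightarrow> ('h \<Rightarrow> 'a \<Rightarrow> 'a) \<Rightarrow> ('k, 'h, 'a) act_alg" where
  "type_alg scale ac =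
     \<lparr>car = UNIV, add = (+), smul = scale, mul = (*), unt = 1, act = ac\<rparr>"

definition tuples :: "('k, 'h, 'x) act_alg \<Rightarrow> nat \<Rightarrow> 'x list set" where
  "tuples M n = {xs. length xs = n \<and> set xs \<subseteq> car M}"

text \<open>\<open>\<Delta>\<^sup>(\<^sup>n\<^sup>) h\<close> as a formal sum of words of length \<open>n + 1\<close>.\<close>

primrec iter_sweedler :: "('k, 'h) hopf_data \<Rightarrow> nat \<Rightarrow> 'h \<Rightarrow> 'h list list" where
  "iter_sweedler H 0 h = [[h]]"
| "iter_sweedler H (Suc n) h = [h0 # w. (h0, h1) \<leftarrow> sweedler H h, w \<leftarrow> iter_sweedler H n h1]"

text \<open>
  An \<open>n\<close>-cochain is a function on lists; it is normalised to be zero off the tuples of \<open>n + 1\<close>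
  elements of the carrier, so that equality of cochains is equality of functions.
\<close>

definition multilinear_cochain ::
    "('k::field, 'h::{ring, monoid_mult}) hopf_data \<Rightarrow> ('k, 'h, 'x) act_alg \<Rightarrow> nat
      \<Rightarrow> ('x list \<Rightarrow> 'h \<Rightarrow> 'k) \<Rightarrow> bool" where
  "multilinear_cochain H M n f \<longleftrightarrow>
     (\<forall>as. as \<notin> tuples M (n + 1) \<longrightarrow> f as = (\<lambda>g. 0)) \<and>
     (\<forall>as\<in>tuples M (n + 1). Vector_Spaces.linear (hscale H) (*) (f as)) \<and>
     (\<forall>as\<in>tuples M (n + 1). \<forall>i\<le>n. \<forall>x\<in>car M. \<forall>y\<in>car M. \<forall>g.
        f (as[i := add M x y]) g = f (as[i := x]) g + f (as[i := y]) g) \<and>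
     (\<forall>as\<in>tuples M (n + 1). \<forall>i\<le>n. \<forall>c. \<forall>x\<in>car M. \<forall>g.
        f (as[i := smul M c x]) g = c * f (as[i := x]) g)"

definition cochains ::
    "('k::field, 'h::{ring, monoid_mult}) hopf_data \<Rightarrow> ('k, 'h, 'x) act_alg \<Rightarrow> nat
      \<Rightarrow> ('x list \<Rightarrow> 'h \<Rightarrow> 'k) set" where
  "cochains H M n = {f. multilinear_cochain H M n f \<and>
     (\<forall>as\<in>tuples M (n + 1). \<forall>h g.
        (\<Sum>hs\<leftarrow>iter_sweedler H n h. f (map2 (act M) hs as) g) =
        (\<Sum>(h0, h1)\<leftarrow>sweedler H h. f as (antipode H h1 * g * h0)))}"

text \<open>\<open>\<partial>\<^sup>i\<close> from \<open>(n - 1)\<close>-cochains to \<open>n\<close>-cochains, for \<open>n \<ge> 1\<close> and \<open>i \<le> n\<close>.\<close>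

definition coface ::
    "('k::field, 'h::{ring, monoid_mult}) hopf_data \<Rightarrow> ('k, 'h, 'x) act_alg \<Rightarrow> nat \<Rightarrow> nat
      \<Rightarrow> ('x list \<Rightarrow> 'h \<Rightarrow> 'k) \<Rightarrow> 'x list \<Rightarrow> 'h \<Rightarrow> 'k" where
  "coface H M n i f as g =
     (if as \<notin> tuples M (n + 1) then 0
      else if i < n then f (take i as @ mul M (as ! i) (as ! (i + 1)) # drop (i + 2) as) g
      else (\<Sum>(g0, g1)\<leftarrow>sweedler H g.
              f (mul M (act M (inv (antipode H) g0) (as ! n)) (as ! 0) # drop 1 (take n as)) g1))"

text \<open>\<open>\<sigma>\<^sup>i\<close> from \<open>(n + 1)\<close>-cochains to \<open>n\<close>-cochains, for \<open>i \<le> n\<close>.\<close>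

definition codegeneracy ::
    "('k::field, 'h, 'x) act_alg \<Rightarrow> nat \<Rightarrow> nat
      \<Rightarrow> ('x list \<Rightarrow> 'h \<Rightarrow> 'k) \<Rightarrow> 'x list \<Rightarrow> 'h \<Rightarrow> 'k" where
  "codegeneracy M n i f as g =
     (if as \<notin> tuples M (n + 1) then 0
      else f (take (i + 1) as @ unt M # drop (i + 1) as) g)"

definition cyclic_op ::
    "('k::field, 'h::{ring, monoid_mult}) hopf_data \<Rightarrow> ('k, 'h, 'x) act_alg \<Rightarrow> nat
      \<Rightarrow> ('x list \<Rightarrow> 'h \<Rightarrow> 'k) \<Rightarrow> 'x list \<Rightarrow> 'h \<Rightarrow> 'k" where
  "cyclic_op H M n f as g =
     (if as \<notin> tuples M (n + 1) then 0
      else (\<Sum>(g0, g1)\<leftarrow>sweedler H g.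
              f (act M (inv (antipode H) g0) (as ! n) # take n as) g1))"


section \<open>The algebra \<open>A \<otimes> End(V)\<close> and the map \<open>\<Psi>\<close>\<close>

definition finite_dim :: "('k::field \<Rightarrow> 'v::ab_group_add \<Rightarrow> 'v) \<Rightarrow> bool" where
  "finite_dim scale \<longleftrightarrow> (\<exists>B. finite B \<and> module.span scale B = UNIV)"

definition trace :: "('k::field \<Rightarrow> 'v::ab_group_add \<Rightarrow> 'v) \<Rightarrow> ('v \<Rightarrow> 'v) \<Rightarrow> 'k" where
  "trace scale u =
     (let B = (SOME B. \<not> module.dependent scale B \<and> module.span scale B = UNIV)
      in \<Sum>b\<in>B. module.representation scale B (u b) b)"

definition endos :: "('k::field \<Rightarrow> 'v::ab_group_add \<Rightarrow> 'v) \<Rightarrow> ('v \<Rightarrow> 'v) set" where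
  "endos scale = {u. Vector_Spaces.linear scale scale u}"

definition end_scale :: "('k \<Rightarrow> 'v \<Rightarrow> 'v) \<Rightarrow> 'k \<Rightarrow> ('v \<Rightarrow> 'v) \<Rightarrow> 'v \<Rightarrow> 'v" where
  "end_scale scale c u = (\<lambda>v. scale c (u v))"

definition end_act ::
    "('k, 'h) hopf_data \<Rightarrow> ('h \<Rightarrow> 'v::ab_group_add \<Rightarrow> 'v) \<Rightarrow> 'h \<Rightarrow> ('v \<Rightarrow> 'v) \<Rightarrow> 'v \<Rightarrow> 'v" where
  "end_act H actV h u = (\<Sum>(h0, h1)\<leftarrow>sweedler H h. actV h0 \<circ> u \<circ> actV (antipode H h1))"

definition end_class ::
    "('k::field \<Rightarrow> 'a::ab_group_add \<Rightarrow> 'a) \<Rightarrow> ('k \<Rightarrow> 'v::ab_group_add \<Rightarrow> 'v)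
      \<Rightarrow> ('a \<times> ('v \<Rightarrow> 'v)) list \<Rightarrow> ('a \<times> ('v \<Rightarrow> 'v)) list set" where
  "end_class scaleA scaleV = tensor_class UNIV scaleA (endos scaleV) (end_scale scaleV)"

definition end_alg ::
    "('k::field, 'h::{ring, monoid_mult}) hopf_data
      \<Rightarrow> ('k \<Rightarrow> 'a::{ring, monoid_mult} \<Rightarrow> 'a) \<Rightarrow> ('h \<Rightarrow> 'a \<Rightarrow> 'a) \<Rightarrow> ('a \<Rightarrow> ('a \<times> 'h) list set)
      \<Rightarrow> ('k \<Rightarrow> 'v::ab_group_add \<Rightarrow> 'v) \<Rightarrow> ('h \<Rightarrow> 'v \<Rightarrow> 'v)
      \<Rightarrow> ('k, 'h, ('a \<times> ('v \<Rightarrow> 'v)) list set) act_alg" where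
  "end_alg H scaleA actA coact scaleV actV =
     \<lparr>car = tensor_space UNIV scaleA (endos scaleV) (end_scale scaleV),
      add = tensor_add UNIV scaleA (endos scaleV) (end_scale scaleV),
      smul = tensor_scale UNIV scaleA (endos scaleV) (end_scale scaleV),
      mul = (\<lambda>p q. end_class scaleA scaleV
               [(a * c0, end_act H actV c1 u \<circ> v).
                  (a, u) \<leftarrow> sw p, (c, v) \<leftarrow> sw q, (c0, c1) \<leftarrow> sw (coact c)]),
      unt = end_class scaleA scaleV [(1, id)],
      act = (\<lambda>h p. end_class scaleA scaleV
               [(actA h0 a, end_act H actV h1 u). (a, u) \<leftarrow> sw p, (h0, h1) \<leftarrow> sweedler H h])\<rparr>"

text \<open>
  The defining formula of \<open>\<Psi>\<^sup>n f\<close> on pure tensors: \<open>aus\<close> is the list of the pairs \<open>(a\<^sub>i, u\<^sub>i)\<close>, and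
  \<open>xs\<close> runs through the choices of one term of each \<open>\<rho>(a\<^sub>i)\<close>.
\<close>

definition Psi_pure ::
    "('k::field, 'h::{ring, monoid_mult}) hopf_data \<Rightarrow> ('a \<Rightarrow> ('a \<times> 'h) list set)
      \<Rightarrow> ('k \<Rightarrow> 'v::ab_group_add \<Rightarrow> 'v) \<Rightarrow> ('h \<Rightarrow> 'v \<Rightarrow> 'v)
      \<Rightarrow> ('a list \<Rightarrow> 'h \<Rightarrow> 'k) \<Rightarrow> ('a \<times> ('v \<Rightarrow> 'v)) list \<Rightarrow> 'h \<Rightarrow> 'k" where
  "Psi_pure H coact scaleV actV f aus g =
     (\<Sum>(g0, g1)\<leftarrow>sweedler H g.
        \<Sum>xs\<leftarrow>product_lists (map (\<lambda>(a, u). sw (coact a)) aus).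
          f (map fst xs) g1 *
          trace scaleV
            (foldr (\<circ>) (map2 (\<lambda>(a0, a1) (a, u). actV (antipode H a1) \<circ> u) xs aus) (actV g0)))"

text \<open>Multilinear extension of \<open>Psi_pure\<close> to all of \<open>A \<otimes> End(V)\<close>.\<close>

definition Psi ::
    "('k::field, 'h::{ring, monoid_mult}) hopf_data
      \<Rightarrow> ('k \<Rightarrow> 'a::{ring, monoid_mult} \<Rightarrow> 'a) \<Rightarrow> ('h \<Rightarrow> 'a \<Rightarrow> 'a) \<Rightarrow> ('a \<Rightarrow> ('a \<times> 'h) list set)
      \<Rightarrow> ('k \<Rightarrow> 'v::ab_group_add \<Rightarrow> 'v) \<Rightarrow> ('h \<Rightarrow> 'v \<Rightarrow> 'v) \<Rightarrow> nat
      \<Rightarrow> ('a list \<Rightarrow> 'h \<Rightarrow> 'k) \<Rightarrow> ('a \<times> ('v \<Rightarrow> 'v)) list set list \<Rightarrow> 'h \<Rightarrow> 'k" where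
  "Psi H scaleA actA coact scaleV actV n f bs g =
     (if bs \<notin> tuples (end_alg H scaleA actA coact scaleV actV) (n + 1) then 0
      else \<Sum>aus\<leftarrow>product_lists (map sw bs). Psi_pure H coact scaleV actV f aus g)"

text \<open>Morphisms between the cocyclic modules of two algebras.\<close>

definition cocyclic_morphism ::
    "('k::field, 'h::{ring, monoid_mult}) hopf_data
      \<Rightarrow> ('k, 'h, 'x) act_alg \<Rightarrow> ('k, 'h, 'y) act_alg
      \<Rightarrow> (nat \<Rightarrow> ('x list \<Rightarrow> 'h \<Rightarrow> 'k) \<Rightarrow> ('y list \<Rightarrow> 'h \<Rightarrow> 'k)) \<Rightarrow> bool" where
  "cocyclic_morphism H M N \<Phi> \<longleftrightarrow>
     (\<forall>n. \<forall>f\<in>cochains H M n. \<Phi> n f \<in> cochains H N n) \<and>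
     (\<forall>n. \<forall>f\<in>cochains H M n. \<forall>f'\<in>cochains H M n. \<forall>bs g.
        \<Phi> n (\<lambda>as g. f as g + f' as g) bs g = \<Phi> n f bs g + \<Phi> n f' bs g) \<and>
     (\<forall>n c. \<forall>f\<in>cochains H M n. \<forall>bs g. \<Phi> n (\<lambda>as g. c * f as g) bs g = c * \<Phi> n f bs g) \<and>
     (\<forall>n\<ge>1. \<forall>i\<le>n. \<forall>f\<in>cochains H M (n - 1).
        \<Phi> n (coface H M n i f) = coface H N n i (\<Phi> (n - 1) f)) \<and>
     (\<forall>n. \<forall>i\<le>n. \<forall>f\<in>cochains H M (n + 1).
        \<Phi> n (codegeneracy M n i f) = codegeneracy N n i (\<Phi> (n + 1) f)) \<and>
     (\<forall>n. \<forall>f\<in>cochains H M n. \<Phi> n (cyclic_op H M n f) = cyclic_op H N n (\<Phi> n f))"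

end

theory Submission
  imports Defs
begin

text \<open>
  The map \<open>\<theta>(a \<otimes> u) = a\<^sub>0 \<otimes> S(a\<^sub>1)u\<close> carries the twisted product of \<open>A \<otimes> End(V)\<close> to the ordinary
  one, \<open>(a \<otimes> w)(a' \<otimes> w') = aa' \<otimes> ww'\<close>, and the action of \<open>h\<close> to
  \<open>a \<otimes> w \<mapsto> h\<^sub>1 \<cdot> a \<otimes> h\<^sub>0 w S(h\<^sub>2)\<close>; the latter is the Yetter-Drinfeld condition in the form
  \<open>\<rho>(h \<cdot> a) = h\<^sub>1 \<cdot> a\<^sub>0 \<otimes> h\<^sub>2 a\<^sub>1 S\<^sup>-\<^sup>1(h\<^sub>0)\<close>. After \<open>\<theta>\<close>, the map \<open>\<Psi>\<close> is just
  \<open>f(a\<^sub>0, \<dots>, a\<^sub>n)(g\<^sub>1) tr(w\<^sub>0 \<cdots> w\<^sub>n g\<^sub>0)\<close>. In an iterated action the inner factors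
  \<open>S(h\<^sub>i) h\<^bsub>i+1\<^esub>\<close> cancel, so equivariance and the compatibility with the cyclic operator reduce to the
  cyclicity of the trace. The last coface is \<open>T\<^sub>n \<partial>\<^sup>0\<close>.
\<close>

section \<open>Sums over formal tensors\<close>

text \<open>The representative picked by \<open>sw\<close> is arbitrary, so a Sweedler identity need
  not hold between the chosen lists; it holds after summation against a multilinear function. The
  coproduct and coaction axioms are therefore restated as equalities of such sums, at the price of
  one linearity condition per argument, and the collections of \<open>lin_on\<close> rules exist to
  pay it. For the same reason \<theta> is not built as a map between quotient spaces. It occurs in
  two dual forms: \<open>theta\<close> pulls a bilinear form back, and \<open>twist_list\<close>
  expands a representative. Only their pairing is ever evaluated, and there the choice of
  representative no longer matters.\<close>

definition psum :: "('x \<times> 'y) list \<Rightarrow> ('x \<Rightarrow> 'y \<Rightarrow> 'z::comm_monoid_add) \<Rightarrow> 'z" where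
  "psum xs F = (\<Sum>(x, y)\<leftarrow>xs. F x y)"

lemma psum_Nil [simp]: "psum [] F = 0"
  and psum_Cons [simp]: "psum ((x, y) # xs) F = F x y + psum xs F"
  and psum_append [simp]: "psum (xs @ ys) F = psum xs F + psum ys F"
  by (simp_all add: psum_def)

lemma psum_concat [simp]:
  "psum (concat (map (\<lambda>(x, y). G x y) xs)) F = psum xs (\<lambda>x y. psum (G x y) F)"
  by (induction xs) (auto)

lemma psum_map [simp]:
  "psum (map (\<lambda>(x, y). (P x y, Q x y)) xs) F = psum xs (\<lambda>x y. F (P x y) (Q x y))"
  by (induction xs) (auto)

lemma sum_list_concat_pairs:
  "sum_list (map F (concat (map (\<lambda>(x, y). G x y) xs))) = psum xs (\<lambda>x y. sum_list (map F (G x y)))"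
  by (induction xs) auto

lemma psum_cong:
  "(\<And>x y. (x, y) \<in> set xs \<Longrightarrow> F x y = G x y) \<Longrightarrow> psum xs F = psum xs G"
  unfolding psum_def by (intro arg_cong[of _ _ sum_list] map_cong) auto

lemma psum_add: "psum xs (\<lambda>x y. F x y + G x y) = psum xs F + psum xs G"
  by (induction xs) (auto simp: algebra_simps)

lemma psum_zero [simp]: "psum xs (\<lambda>x y. 0) = 0"
  by (induction xs) auto

lemma psum_additive:
  assumes "h 0 = 0" and "\<And>x y. h (x + y) = h x + h y"
  shows "h (psum xs F) = psum xs (\<lambda>x y. h (F x y))"
  using assms by (induction xs) auto

lemma psum_mult_left: "(c::'k::semiring_0) * psum xs F = psum xs (\<lambda>x y. c * F x y)"
  by (rule psum_additive) (auto simp: algebra_simps)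

lemma psum_mult_right: "psum xs F * (c::'k::semiring_0) = psum xs (\<lambda>x y. F x y * c)"
  by (rule psum_additive[where h = "\<lambda>x. x * c"]) (auto simp: algebra_simps)

lemma psum_swap:
  "psum xs (\<lambda>x y. psum ys (\<lambda>u v. F x y u v)) = psum ys (\<lambda>u v. psum xs (\<lambda>x y. F x y u v))"
proof (induction xs)
  case Nil
  show ?case by (induction ys) auto
next
  case (Cons p xs)
  then show ?case by (cases p) (simp add: psum_add)
qed

lemma psum_sum_list_swap:
  "psum xs (\<lambda>x y. \<Sum>z\<leftarrow>zs. F x y z) = (\<Sum>z\<leftarrow>zs. psum xs (\<lambda>x y. F x y z))"
  by (induction zs) (auto simp: psum_add)

text \<open>A carrier is needed because End(V) is only the subset \<open>endos\<close> of a function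
  type. Closure of \<open>C\<close> is not built in, so that the rules for compositions and sums
  stay free of closure conditions; it is supplied where sums are pulled through
  \<open>F\<close>.\<close>

definition lin_on ::
    "'x::plus set \<Rightarrow> ('k \<Rightarrow> 'x \<Rightarrow> 'x) \<Rightarrow> ('k \<Rightarrow> 'z \<Rightarrow> 'z::plus) \<Rightarrow> ('x \<Rightarrow> 'z) \<Rightarrow> bool" where
  "lin_on C s t F \<longleftrightarrow>
     (\<forall>x\<in>C. \<forall>y\<in>C. F (x + y) = F x + F y) \<and> (\<forall>c. \<forall>x\<in>C. F (s c x) = t c (F x))"

lemma lin_onI:
  "(\<And>x y. x \<in> C \<Longrightarrow> y \<in> C \<Longrightarrow> F (x + y) = F x + F y) \<Longrightarrow>
   (\<And>c x. x \<in> C \<Longrightarrow> F (s c x) = t c (F x)) \<Longrightarrow> lin_on C s t F"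
  by (auto simp: lin_on_def)

lemma lin_on_add: "lin_on C s t F \<Longrightarrow> x \<in> C \<Longrightarrow> y \<in> C \<Longrightarrow> F (x + y) = F x + F y"
  and lin_on_scale: "lin_on C s t F \<Longrightarrow> x \<in> C \<Longrightarrow> F (s c x) = t c (F x)"
  by (auto simp: lin_on_def)

lemma lin_on_zero:
  fixes F :: "'x::ab_group_add \<Rightarrow> 'z::ab_group_add"
  shows "lin_on C s t F \<Longrightarrow> 0 \<in> C \<Longrightarrow> F 0 = 0"
  using lin_on_add[of C s t F 0 0] by simp

lemma lin_on_psum:
  fixes F :: "'x::ab_group_add \<Rightarrow> 'z::ab_group_add"
  assumes "lin_on C s t F" and "0 \<in> C" and "\<And>x y. x \<in> C \<Longrightarrow> y \<in> C \<Longrightarrow> x + y \<in> C"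
    and "\<And>x y. (x, y) \<in> set xs \<Longrightarrow> G x y \<in> C"
  shows "F (psum xs G) = psum xs (\<lambda>x y. F (G x y))"
proof -
  \<comment> \<open>Additivity is available only inside \<open>C\<close>, so membership of the
    partial sums is carried through the induction.\<close>
  have "psum xs G \<in> C \<and> F (psum xs G) = psum xs (\<lambda>x y. F (G x y))"
    using assms(4)
  proof (induction xs)
    case Nil
    show ?case using assms(1,2) by (simp add: lin_on_zero)
  next
    case (Cons p xs)
    obtain x y where p: "p = (x, y)" by (cases p)
    have "G x y \<in> C" "psum xs G \<in> C" "F (psum xs G) = psum xs (\<lambda>x y. F (G x y))"
      using Cons p by auto
    then show ?case
      using assms(1,3) by (simp add: p lin_on_add)
  qed
  then show ?thesis ..
qed

lemma lin_psum:
  fixes F :: "'x::ab_group_add \<Rightarrow> 'z::ab_group_add"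
  assumes "lin_on UNIV s t F"
  shows "F (psum xs G) = psum xs (\<lambda>x y. F (G x y))"
  by (rule lin_on_psum[OF assms]) auto

lemma lin_on_id: "lin_on C s s (\<lambda>x. x)"
  by (auto simp: lin_on_def)

lemma lin_on_comp:
  assumes "lin_on D s' t G" and "lin_on C s s' T" and "\<And>x. x \<in> C \<Longrightarrow> T x \<in> D"
  shows "lin_on C s t (\<lambda>x. G (T x))"
  using assms by (auto simp: lin_on_def)

lemma lin_comp:
  assumes "lin_on UNIV s' t G" and "lin_on C s s' T"
  shows "lin_on C s t (\<lambda>x. G (T x))"
  using assms by (auto simp: lin_on_def)

lemma lin_on_psum_const:
  fixes t :: "'k::field \<Rightarrow> 'z::ab_group_add \<Rightarrow> 'z"
  assumes "vector_space t" and F: "\<And>u v. (u, v) \<in> set l \<Longrightarrow> lin_on C s t (\<lambda>x. F x u v)"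
  shows "lin_on C s t (\<lambda>x. psum l (F x))"
proof -
  interpret vector_space t by fact
  have "psum l (F (x + y)) = psum l (F x) + psum l (F y)" if "x \<in> C" "y \<in> C" for x y
    using that by (subst psum_add[symmetric]) (auto intro!: psum_cong simp: lin_on_add[OF F])
  moreover have "psum l (F (s c x)) = t c (psum l (F x))" if "x \<in> C" for c x
    using that by (subst psum_additive[where h = "t c"])
      (auto intro!: psum_cong simp: lin_on_scale[OF F] scale_right_distrib)
  ultimately show ?thesis by (auto simp: lin_on_def)
qed

lemma lin_on_sum_list_const:
  fixes t :: "'k::field \<Rightarrow> 'z::ab_group_add \<Rightarrow> 'z"
  assumes "vector_space t" and F: "\<And>u. u \<in> set l \<Longrightarrow> lin_on C s t (\<lambda>x. F x u)"
  shows "lin_on C s t (\<lambda>x. \<Sum>u\<leftarrow>l. F x u)"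
proof -
  interpret vector_space t by fact
  show ?thesis
    using F
  proof (induction l)
    case Nil
    show ?case by (simp add: lin_on_def)
  next
    case (Cons u l)
    then have "lin_on C s t (\<lambda>x. F x u)" "lin_on C s t (\<lambda>x. \<Sum>u\<leftarrow>l. F x u)" by auto
    then show ?case by (auto simp: lin_on_def scale_right_distrib algebra_simps)
  qed
qed

lemma lin_on_mult_left:
  "unital_algebra t \<Longrightarrow> lin_on C s t T \<Longrightarrow> lin_on C s t (\<lambda>x. T x * y)"
  and lin_on_mult_right:
  "unital_algebra t \<Longrightarrow> lin_on C s t T \<Longrightarrow> lin_on C s t (\<lambda>x. y * T x)"
  by (auto simp: lin_on_def unital_algebra.scale_mult_left unital_algebra.scale_mult_right
      distrib_left distrib_right)

lemma lin_on_scale_left: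
  "vector_space t \<Longrightarrow> lin_on C s (*) T \<Longrightarrow> lin_on C s t (\<lambda>x. t (T x) y)"
  by (auto simp: lin_on_def vector_space.vector_space_assms)

lemma vector_space_field: "vector_space ((*) :: 'k::field \<Rightarrow> 'k \<Rightarrow> 'k)"
  by unfold_locales (auto simp: algebra_simps)

lemma unital_algebra_field: "unital_algebra ((*) :: 'k::field \<Rightarrow> 'k \<Rightarrow> 'k)"
  by unfold_locales (auto simp: algebra_simps)

lemma linear_lin: "Vector_Spaces.linear s t F \<Longrightarrow> lin_on UNIV s t F"
  by (simp add: lin_on_def Vector_Spaces.linear_iff)

lemma lin_linear:
  "vector_space s \<Longrightarrow> vector_space t \<Longrightarrow> lin_on UNIV s t F \<Longrightarrow> Vector_Spaces.linear s t F"
  by (simp add: lin_on_def Vector_Spaces.linear_iff)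

section \<open>Descent of sums from formal lists to tensor classes\<close>

lemma formal_eq_sum_list:
  assumes "formal_eq G R xs ys"
    and "\<And>xs ys. (xs, ys) \<in> R \<Longrightarrow> sum_list (map F xs) = sum_list (map F ys)"
  shows "sum_list (map F xs) = sum_list (map (F :: _ \<Rightarrow> 'z::ab_group_add) ys)"
  using assms by (induction rule: formal_eq.induct) (auto simp: add.commute)

lemma formal_eq_lists:
  assumes "formal_eq G R xs ys" and "\<And>xs ys. (xs, ys) \<in> R \<Longrightarrow> xs \<in> lists G \<and> ys \<in> lists G"
  shows "xs \<in> lists G \<and> ys \<in> lists G"
  using assms by (induction rule: formal_eq.induct) auto

definition bilin_on where
  "bilin_on X s Y t r F \<longleftrightarrow>
     (\<forall>y\<in>Y. lin_on X s r (\<lambda>x. F x y)) \<and> (\<forall>x\<in>X. lin_on Y t r (F x))"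

lemma bilin_onI:
  "(\<And>y. y \<in> Y \<Longrightarrow> lin_on X s r (\<lambda>x. F x y)) \<Longrightarrow> (\<And>x. x \<in> X \<Longrightarrow> lin_on Y t r (F x)) \<Longrightarrow>
   bilin_on X s Y t r F"
  by (auto simp: bilin_on_def)

text \<open>Uniqueness of values in the universal property of the tensor product: a bilinear map
  respects each generating relation. For the relation deleting \<open>(0, y)\<close>, membership of
  0 in \<open>X\<close> lets additivity give F 0 y = 0.\<close>

lemma formal_eq_psum:
  fixes F :: "'a::ab_group_add \<Rightarrow> 'b::ab_group_add \<Rightarrow> 'z::ab_group_add"
  assumes "formal_eq (X \<times> Y) (tensor_rels X s Y t) xs ys"
    and F: "bilin_on X s Y t r F" and "0 \<in> X"
  shows "psum xs F = psum ys F"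
  unfolding psum_def
proof (rule formal_eq_sum_list[OF assms(1)])
  have F1: "lin_on X s r (\<lambda>x. F x y)" if "y \<in> Y" for y
    using F that by (simp add: bilin_on_def)
  have F2: "lin_on Y t r (F x)" if "x \<in> X" for x
    using F that by (simp add: bilin_on_def)
  fix xs ys assume "(xs, ys) \<in> tensor_rels X s Y t"
  then show "(\<Sum>(x, y)\<leftarrow>xs. F x y) = (\<Sum>(x, y)\<leftarrow>ys. F x y)"
    unfolding tensor_rels_def
    by (auto simp: lin_on_add[OF F1] lin_on_add[OF F2] lin_on_scale[OF F1] lin_on_scale[OF F2]
        lin_on_zero[OF F1 \<open>0 \<in> X\<close>])
qed

lemma tensor_rels_lists:
  assumes "(xs, ys) \<in> tensor_rels X s Y t" and "0 \<in> X"
    and "\<And>x y. x \<in> X \<Longrightarrow> y \<in> X \<Longrightarrow> x + y \<in> X" and "\<And>c x. x \<in> X \<Longrightarrow> s c x \<in> X"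
    and "\<And>x y. x \<in> Y \<Longrightarrow> y \<in> Y \<Longrightarrow> x + y \<in> Y" and "\<And>c x. x \<in> Y \<Longrightarrow> t c x \<in> Y"
  shows "xs \<in> lists (X \<times> Y) \<and> ys \<in> lists (X \<times> Y)"
  using assms unfolding tensor_rels_def by auto

lemma sw_tensor_class:
  "xs \<in> lists (X \<times> Y) \<Longrightarrow>
    formal_eq (X \<times> Y) (tensor_rels X s Y t) xs (sw (tensor_class X s Y t xs))"
  unfolding sw_def tensor_class_def by (rule someI2[of _ xs]) (auto intro: formal_eq.refl)

text \<open>This is how the arbitrary choice in \<open>sw\<close> disappears: under a bilinear
  summand it may be replaced by the list that defines the class.\<close>

lemma psum_class:
  fixes F :: "'a::ab_group_add \<Rightarrow> 'b::ab_group_add \<Rightarrow> 'z::ab_group_add"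
  assumes "bilin_on X s Y t r F" and "0 \<in> X" and "xs \<in> lists (X \<times> Y)"
  shows "psum (sw (tensor_class X s Y t xs)) F = psum xs F"
  using formal_eq_psum[OF sw_tensor_class[OF assms(3)] assms(1,2)] by simp

text \<open>The list being summed over changes with x, so linearity cannot be checked term by term.
  It comes from linearity of \<Delta> into the tensor space, followed by a change of
  representative.\<close>

lemma linear_into_tensor_psum:
  fixes F :: "'a::ab_group_add \<Rightarrow> 'b::ab_group_add \<Rightarrow> 'z::ab_group_add"
    and t :: "'k::field \<Rightarrow> _"
  assumes "linear_into_tensor r s t \<Delta>" and F: "bilin_on UNIV s UNIV t q F" and "vector_space q"
  shows "lin_on UNIV r q (\<lambda>x. psum (sw (\<Delta> x)) F)"
proof (rule lin_onI)
  fix x y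
  show "psum (sw (\<Delta> (x + y))) F = psum (sw (\<Delta> x)) F + psum (sw (\<Delta> y)) F"
    using assms(1) psum_class[OF F] by (simp add: linear_into_tensor_def tensor_add_def)
next
  fix c x
  interpret vector_space q by fact
  have "psum (sw (\<Delta> (r c x))) F = psum (sw (\<Delta> x)) (\<lambda>x y. F (s c x) y)"
    using assms(1) psum_class[OF F] by (simp add: linear_into_tensor_def tensor_scale_def)
  also have "\<dots> = psum (sw (\<Delta> x)) (\<lambda>x y. q c (F x y))"
    using F by (auto intro!: psum_cong simp: bilin_on_def lin_on_def)
  also have "\<dots> = q c (psum (sw (\<Delta> x)) F)"
    by (rule psum_additive[symmetric]) (auto simp: scale_right_distrib)
  finally show "psum (sw (\<Delta> (r c x))) F = q c (psum (sw (\<Delta> x)) F)" .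
qed

lemma tensor3_eq_sum:
  fixes F :: "'a::ab_group_add \<Rightarrow> 'b::ab_group_add \<Rightarrow> 'c::ab_group_add \<Rightarrow> 'z::ab_group_add"
  assumes "tensor3_eq r s t xs ys"
    and F: "\<And>y z. lin_on UNIV r q (\<lambda>x. F x y z)" "\<And>x z. lin_on UNIV s q (\<lambda>y. F x y z)"
      "\<And>x y. lin_on UNIV t q (\<lambda>z. F x y z)"
  shows "(\<Sum>(x, y, z)\<leftarrow>xs. F x y z) = (\<Sum>(x, y, z)\<leftarrow>ys. F x y z)"
proof (rule formal_eq_sum_list[OF assms(1)[unfolded tensor3_eq_def]])
  fix xs ys assume "(xs, ys) \<in> tensor3_rels r s t"
  then show "(\<Sum>(x, y, z)\<leftarrow>xs. F x y z) = (\<Sum>(x, y, z)\<leftarrow>ys. F x y z)"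
    unfolding tensor3_rels_def
    by (auto simp: lin_on_add[OF F(1)] lin_on_add[OF F(2)] lin_on_add[OF F(3)]
        lin_on_scale[OF F(1)] lin_on_scale[OF F(2)] lin_on_scale[OF F(3)]
        lin_on_zero[OF F(1)])
qed

section \<open>Hopf algebras in Sweedler form\<close>

context hopf_algebra
begin

abbreviation "hs \<equiv> hscale H"
abbreviation "S \<equiv> antipode H"
abbreviation "\<epsilon> \<equiv> counit H"
abbreviation "D h \<equiv> psum (sweedler H h)"

lemma vector_space_hs: "vector_space hs"
  using algebra by (simp add: unital_algebra_def)

lemma lin_sweedler:
  fixes F :: "'h \<Rightarrow> 'h \<Rightarrow> 'z::ab_group_add"
  assumes "vector_space q" and "lin_on C s hs T"
    and "\<And>y. lin_on UNIV hs q (\<lambda>x. F x y)" and "\<And>x. lin_on UNIV hs q (F x)"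
  shows "lin_on C s q (\<lambda>x. D (T x) F)"
  by (rule lin_comp[OF linear_into_tensor_psum[OF comult_linear bilin_onI] assms(2)])
    (use assms in auto)

lemmas lin_antipode = lin_comp[OF linear_lin[OF antipode_linear]]

text \<open>These rules prove linearity in one variable of expressions built from products,
  antipodes, counits and nested Sweedler sums. They discharge the side conditions of each
  coassociativity or collapse step.\<close>

lemmas lin_intros = lin_on_id lin_on_mult_left[OF algebra] lin_on_mult_right[OF algebra]
  lin_on_mult_left[OF unital_algebra_field] lin_on_mult_right[OF unital_algebra_field]
  lin_antipode lin_comp[OF linear_lin[OF counit_linear]]
  lin_on_scale_left[OF vector_space_hs]
  lin_on_psum_const[OF vector_space_hs] lin_on_psum_const[OF vector_space_field]
  lin_sweedler[OF vector_space_hs] lin_sweedler[OF vector_space_field]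

lemma coassoc_psum:
  fixes F :: "'h \<Rightarrow> 'h \<Rightarrow> 'h \<Rightarrow> 'z::ab_group_add"
  assumes "\<And>y z. lin_on UNIV hs q (\<lambda>x. F x y z)" "\<And>x z. lin_on UNIV hs q (\<lambda>y. F x y z)"
      "\<And>x y. lin_on UNIV hs q (\<lambda>z. F x y z)"
  shows "D h (\<lambda>h0 h1. D h0 (\<lambda>x y. F x y h1)) = D h (\<lambda>h0 h1. D h1 (\<lambda>x y. F h0 x y))"
  using tensor3_eq_sum[OF coassoc[of h] assms]
  unfolding sum_list_concat_pairs by (simp add: psum_def comp_def case_prod_unfold)

lemma comult_mult_psum:
  fixes F :: "'h \<Rightarrow> 'h \<Rightarrow> 'z::ab_group_add"
  assumes "\<And>y. lin_on UNIV hs q (\<lambda>x. F x y)" and "\<And>x. lin_on UNIV hs q (F x)"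
  shows "D (g * h) F = D g (\<lambda>g0 g1. D h (\<lambda>h0 h1. F (g0 * h0) (g1 * h1)))"
  using psum_class[OF bilin_onI[of UNIV UNIV hs q F hs], OF assms] comult_mult by simp

lemma comult_one_psum:
  fixes F :: "'h \<Rightarrow> 'h \<Rightarrow> 'z::ab_group_add"
  assumes "\<And>y. lin_on UNIV hs q (\<lambda>x. F x y)" and "\<And>x. lin_on UNIV hs q (F x)"
  shows "D 1 F = F 1 1"
  using psum_class[OF bilin_onI[of UNIV UNIV hs q F hs], OF assms, of "[(1, 1)]"] comult_one by simp

lemma counit_left_psum:
  fixes F :: "'h \<Rightarrow> 'z::ab_group_add"
  assumes "lin_on UNIV hs q F"
  shows "D h (\<lambda>x y. F (hs (\<epsilon> x) y)) = F h"
  unfolding lin_psum[OF assms, symmetric] using counit_left[of h] by (simp add: psum_def)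

lemma counit_right_psum:
  fixes F :: "'h \<Rightarrow> 'z::ab_group_add"
  assumes "lin_on UNIV hs q F"
  shows "D h (\<lambda>x y. F (hs (\<epsilon> y) x)) = F h"
  unfolding lin_psum[OF assms, symmetric] using counit_right[of h] by (simp add: psum_def)

lemma antipode_left_psum: "D h (\<lambda>x y. S x * y) = hs (\<epsilon> h) 1"
  and antipode_right_psum: "D h (\<lambda>x y. x * S y) = hs (\<epsilon> h) 1"
  using antipode_left[of h] antipode_right[of h] by (simp_all add: psum_def)

text \<open>In a collapse, \<open>m x y\<close> is one of \<open>S x * y\<close>, \<open>x * S y\<close> and \<open>y * S\<^sup>-\<^sup>1 x\<close>.\<close>

lemma collapse_left:
  fixes G :: "'h \<Rightarrow> 'h \<Rightarrow> 'z::ab_group_add"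
  assumes m: "\<And>h. D h m = hs (\<epsilon> h) 1"
    and m_lin: "\<And>y. lin_on UNIV hs hs (\<lambda>x. m x y)" "\<And>x. lin_on UNIV hs hs (m x)"
    and G: "\<And>z. lin_on UNIV hs q (\<lambda>x. G x z)" "\<And>x. lin_on UNIV hs q (G x)"
  shows "D h (\<lambda>x r. D r (\<lambda>y z. G (m x y) z)) = G 1 h"
proof -
  have "D h (\<lambda>x r. D r (\<lambda>y z. G (m x y) z)) = D h (\<lambda>r z. D r (\<lambda>x y. G (m x y) z))"
    by (rule coassoc_psum[symmetric, where q = q]) (intro G lin_comp[OF G(1)] m_lin)+
  also have "\<dots> = D h (\<lambda>r z. G 1 (hs (\<epsilon> r) z))"
    by (intro psum_cong)
      (simp add: lin_psum[OF G(1), symmetric] m lin_on_scale[OF G(1)] lin_on_scale[OF G(2)])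
  also have "\<dots> = G 1 h"
    by (rule counit_left_psum[OF G(2)])
  finally show ?thesis .
qed

text \<open>The legs to be contracted already form the inner pair, in contrast with
  \<open>collapse_left\<close>, where coassociativity must first bring them together. The counit law
  in the outer sum finishes.\<close>

lemma collapse_right:
  fixes G :: "'h \<Rightarrow> 'h \<Rightarrow> 'z::ab_group_add"
  assumes m: "\<And>h. D h m = hs (\<epsilon> h) 1"
    and G: "\<And>z. lin_on UNIV hs q (\<lambda>x. G x z)" "\<And>x. lin_on UNIV hs q (G x)"
  shows "D h (\<lambda>z r. D r (\<lambda>x y. G z (m x y))) = G h 1"
proof -
  have "D h (\<lambda>z r. D r (\<lambda>x y. G z (m x y))) = D h (\<lambda>z r. G (hs (\<epsilon> r) z) 1)"
    by (intro psum_cong)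
      (simp add: lin_psum[OF G(2), symmetric] m lin_on_scale[OF G(1)] lin_on_scale[OF G(2)])
  also have "\<dots> = G h 1"
    by (rule counit_right_psum[OF G(1)])
  finally show ?thesis .
qed

section \<open>The antipode reverses products and coproducts\<close>

lemma antipode_one: "S 1 = 1"
  using antipode_left_psum[of 1] vector_space.vector_space_assms(4)[OF vector_space_hs]
  by (subst (asm) comult_one_psum[where q = hs]) (auto simp: counit_one intro!: lin_intros)

lemma antipode_mult: "S (g * h) = S h * S g"
proof -
  txt \<open>Both sides equal \<open>S(g\<^sub>0h\<^sub>0) g\<^sub>1h\<^sub>1 S(h\<^sub>2)S(g\<^sub>2)\<close>.\<close>
  let ?M = "D g (\<lambda>g0 g'. D g' (\<lambda>g1 g2. D h (\<lambda>h0 h'. D h' (\<lambda>h1 h2.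
      S (g0 * h0) * (g1 * (h1 * S h2) * S g2)))))"
  have "?M = D g (\<lambda>g0 g'. D g' (\<lambda>g1 g2. S (g0 * h) * (g1 * 1 * S g2)))"
    by (intro psum_cong collapse_right[OF antipode_right_psum, where q = hs]) (intro lin_intros)+
  also have "\<dots> = D g (\<lambda>g0 g'. D g' (\<lambda>g1 g2. S (g0 * h) * (g1 * S g2)))"
    by simp
  also have "\<dots> = S (g * h) * 1"
    by (intro collapse_right[OF antipode_right_psum, where q = hs]) (intro lin_intros)+
  finally have 1: "?M = S (g * h)" by simp
  have "?M = D g (\<lambda>g' g2. D g' (\<lambda>g0 g1. D h (\<lambda>h0 h'. D h' (\<lambda>h1 h2.
      S (g0 * h0) * (g1 * (h1 * S h2) * S g2)))))"
    by (rule coassoc_psum[symmetric, where q = hs]) (intro lin_intros)+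
  also have "\<dots> = D g (\<lambda>g' g2. D g' (\<lambda>g0 g1. D h (\<lambda>h' h2. D h' (\<lambda>h0 h1.
      S (g0 * h0) * (g1 * (h1 * S h2) * S g2)))))"
    by (rule psum_cong, rule psum_cong, rule coassoc_psum[symmetric, where q = hs])
      (intro lin_intros)+
  also have "\<dots> = D g (\<lambda>g' g2. D h (\<lambda>h' h2. D g' (\<lambda>g0 g1. D h' (\<lambda>h0 h1.
      S (g0 * h0) * (g1 * (h1 * S h2) * S g2)))))"
    by (rule psum_cong, rule psum_swap)
  also have "\<dots> = D g (\<lambda>g' g2. D h (\<lambda>h' h2. D g' (\<lambda>g0 g1. D h' (\<lambda>h0 h1.
      S (g0 * h0) * (g1 * h1) * (S h2 * S g2)))))"
    by (simp add: mult.assoc)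
  also have "\<dots> = D g (\<lambda>g' g2. D h (\<lambda>h' h2. D (g' * h') (\<lambda>x y. S x * y * (S h2 * S g2))))"
    by (rule psum_cong, rule psum_cong, rule comult_mult_psum[where q = hs, symmetric])
      (intro lin_intros)+
  \<comment> \<open>The scalar \<epsilon>(g'h') splits, and each factor is moved inside its own
    antipode, so that the counit law applies to h and g separately.\<close>
  also have "\<dots> = D g (\<lambda>g' g2. D h (\<lambda>h' h2. S (hs (\<epsilon> h') h2) * S (hs (\<epsilon> g') g2)))"
  proof (intro psum_cong)
    fix g' g2 h' h2
    have "D (g' * h') (\<lambda>x y. S x * y * (S h2 * S g2)) = hs (\<epsilon> (g' * h')) 1 * (S h2 * S g2)"
      unfolding antipode_left_psum[symmetric] by (rule psum_mult_right[symmetric])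
    also have "\<dots> = hs (\<epsilon> h') (S h2) * hs (\<epsilon> g') (S g2)"
      by (simp add: counit_mult unital_algebra.scale_mult_left[OF algebra]
          unital_algebra.scale_mult_right[OF algebra] vector_space.vector_space_assms(3)[OF vector_space_hs])
    finally show "D (g' * h') (\<lambda>x y. S x * y * (S h2 * S g2)) =
        S (hs (\<epsilon> h') h2) * S (hs (\<epsilon> g') g2)"
      by (simp add: lin_on_scale[OF linear_lin[OF antipode_linear]])
  qed
  also have "\<dots> = D g (\<lambda>g' g2. S h * S (hs (\<epsilon> g') g2))"
    by (intro psum_cong counit_left_psum[where q = hs] lin_intros)
  also have "\<dots> = S h * S g"
    by (intro counit_left_psum[where q = hs] lin_intros)
  finally show ?thesis using 1 by simp
qed

lemma comult_antipode_psum: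
  fixes F :: "'h \<Rightarrow> 'h \<Rightarrow> 'k"
  assumes "\<And>y. lin_on UNIV hs (*) (\<lambda>x. F x y)" and "\<And>x. lin_on UNIV hs (*) (F x)"
  shows "D (S h) F = D h (\<lambda>x y. F (S y) (S x))"
proof -
  note F = lin_comp[OF assms(1)] lin_comp[OF assms(2)]
  txt \<open>Both sides equal the value of \<open>F\<close> at \<open>\<Delta>(S(h\<^sub>0)) (h\<^sub>1S(h\<^sub>4) \<otimes> h\<^sub>2S(h\<^sub>3))\<close>.\<close>
  let ?M = "D h (\<lambda>h0 r. D r (\<lambda>h1 r1. D r1 (\<lambda>h2 r2. D r2 (\<lambda>h3 h4.
      D (S h0) (\<lambda>p q. F (p * (h1 * S h4)) (q * (h2 * S h3)))))))"
  have "?M = D h (\<lambda>h0 r. D r (\<lambda>h1 r1. D (S h0) (\<lambda>p q. F (p * (h1 * S r1)) (q * 1))))"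
    by (intro psum_cong collapse_left[OF antipode_right_psum, where q = "(*)"])
      (intro F lin_intros)+
  also have "\<dots> = D (S h) (\<lambda>p q. F (p * 1) (q * 1))"
    by (intro collapse_right[OF antipode_right_psum, where q = "(*)"]) (intro F lin_intros)+
  finally have 1: "?M = D (S h) F" by simp
  \<comment> \<open>The second evaluation groups h_1 and h_2 as the coproduct of one element
    \<open>r'\<close>. Then \<Delta>(S(h_0)) \<Delta>(r') becomes \<Delta>(S(h_0) r'), which
    collapses to \<Delta>(1).\<close>
  have "?M = D h (\<lambda>h0 r. D r (\<lambda>r' r2. D r' (\<lambda>h1 h2. D r2 (\<lambda>h3 h4.
      D (S h0) (\<lambda>p q. F (p * (h1 * S h4)) (q * (h2 * S h3)))))))"
    by (rule psum_cong, rule coassoc_psum[symmetric, where q = "(*)"]) (intro F lin_intros)+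
  also have "\<dots> = D h (\<lambda>h0 r. D r (\<lambda>r' r2. D r2 (\<lambda>h3 h4. D (S h0) (\<lambda>p q.
      D r' (\<lambda>h1 h2. F (p * (h1 * S h4)) (q * (h2 * S h3)))))))"
    by (rule psum_cong, rule psum_cong, rule HOL.trans[OF psum_swap], rule psum_cong, rule psum_swap)
  also have "\<dots> = D h (\<lambda>h0 r. D r (\<lambda>r' r2. D r2 (\<lambda>h3 h4. D (S h0) (\<lambda>p q.
      D r' (\<lambda>h1 h2. F (p * h1 * S h4) (q * h2 * S h3))))))"
    by (simp add: mult.assoc)
  also have "\<dots> = D h (\<lambda>h0 r. D r (\<lambda>r' r2. D r2 (\<lambda>h3 h4.
      D (S h0 * r') (\<lambda>u v. F (u * S h4) (v * S h3)))))"
    by (rule psum_cong, rule psum_cong, rule psum_cong,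
        rule comult_mult_psum[where q = "(*)", symmetric]) (intro F lin_intros)+
  also have "\<dots> = D h (\<lambda>h3 h4. D 1 (\<lambda>u v. F (u * S h4) (v * S h3)))"
    by (intro collapse_left[OF antipode_left_psum, where q = "(*)"]) (intro F lin_intros)+
  also have "\<dots> = D h (\<lambda>h3 h4. F (S h4) (S h3))"
    by (rule psum_cong, subst comult_one_psum[where q = "(*)"]) (auto intro!: F lin_intros)
  finally show ?thesis using 1 by simp
qed

end

section \<open>The antipode inverse, traces, and the twist\<close>

locale bijective_hopf_algebra = hopf_algebra +
  assumes bij_antipode: "bij (antipode H)"
begin

abbreviation "J \<equiv> inv (antipode H)"

lemma antipode_J [simp]: "S (J h) = h" and J_antipode [simp]: "J (S h) = h"
  using bij_antipode by (auto simp: bij_def surj_f_inv_f)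

lemma lin_J: "lin_on UNIV hs hs J"
proof (rule lin_onI)
  have S: "lin_on UNIV hs hs S" by (rule linear_lin[OF antipode_linear])
  show "J (x + y) = J x + J y" for x y
    by (metis J_antipode antipode_J lin_on_add[OF S] UNIV_I)
  show "J (hs c x) = hs c (J x)" for c x
    by (metis J_antipode antipode_J lin_on_scale[OF S] UNIV_I)
qed

lemmas lin_intros_inverse = lin_intros lin_comp[OF lin_J]

text \<open>Since S reverses products, it sends y * J x to x * S y, and injectivity of S carries the
  antipode axiom back. Thus \<open>J\<close> is an antipode for the opposite coproduct, which
  explains the order of the legs.\<close>

lemma J_right_psum: "D h (\<lambda>x y. y * J x) = hs (\<epsilon> h) 1"
proof -
  have "S (D h (\<lambda>x y. y * J x)) = D h (\<lambda>x y. x * S y)"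
    by (simp add: lin_psum[OF linear_lin[OF antipode_linear]] antipode_mult)
  also have "\<dots> = S (hs (\<epsilon> h) 1)"
    by (simp add: antipode_right_psum lin_on_scale[OF linear_lin[OF antipode_linear]] antipode_one)
  finally show ?thesis by (metis J_antipode)
qed

lemma comult_J_psum:
  fixes F :: "'b \<Rightarrow> 'b \<Rightarrow> 'a"
  assumes "\<And>y. lin_on UNIV hs (*) (\<lambda>x. F x y)" and "\<And>x. lin_on UNIV hs (*) (F x)"
  shows "D (J h) F = D h (\<lambda>x y. F (J y) (J x))"
proof -
  note F = lin_comp[OF assms(1)] lin_comp[OF assms(2)]
  \<comment> \<open>The reversal rule for S is read at \<open>J h\<close> with a functional whose
    inverses cancel the antipodes it produces.\<close>
  have "D (S (J h)) (\<lambda>x y. F (J y) (J x)) = D (J h) F"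
    by (subst comult_antipode_psum) (intro F lin_intros_inverse | simp)+
  then show ?thesis by simp
qed

end

section \<open>Traces of endomorphisms of a finite dimensional space\<close>

lemma trace_basis:
  assumes "vector_space s" and "finite_dim s"
  obtains B where "\<not> module.dependent s B" "module.span s B = UNIV" "finite B"
    "\<And>u. trace s u = (\<Sum>b\<in>B. module.representation s B (u b) b)"
proof -
  interpret vector_space s by fact
  let ?P = "\<lambda>B. independent B \<and> span B = UNIV"
  define B where "B = (SOME B. ?P B)"
  obtain B' where "B' \<subseteq> UNIV" "independent B'" "UNIV \<subseteq> span B'"
    using maximal_independent_subset[of UNIV] by metis
  then have "?P B'" by auto
  then have B: "?P B" unfolding B_def by (rule someI)
  obtain C where "finite C" "span C = UNIV" using assms(2) by (auto simp: finite_dim_def)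
  then have "finite B" using independent_span_bound[of C B] B by auto
  then show thesis using that[of B] B by (simp add: trace_def B_def[symmetric])
qed

lemma lin_trace:
  assumes "vector_space s" and "finite_dim s"
  shows "lin_on UNIV (end_scale s) (*) (trace s)"
proof -
  interpret vector_space s by fact
  obtain B where B: "independent B" "span B = UNIV"
    "\<And>u. trace s u = (\<Sum>b\<in>B. representation B (u b) b)"
    using trace_basis[OF assms] by metis
  show ?thesis
    by (rule lin_onI)
      (simp_all add: B representation_add representation_scale end_scale_def sum.distrib sum_distrib_left)
qed

lemma trace_comp_commute:
  assumes "vector_space s" and "finite_dim s" and "u \<in> endos s" and "v \<in> endos s"
  shows "trace s (u \<circ> v) = trace s (v \<circ> u)"
proof -
  interpret vector_space s by fact
  obtain B where B: "independent B" "span B = UNIV" "finite B"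
    "\<And>u. trace s u = (\<Sum>b\<in>B. representation B (u b) b)"
    using trace_basis[OF assms(1,2)] by metis
  \<comment> \<open>The trace of a product in matrix entries. Only the outer map is expanded
    linearly, and the double sum is symmetric up to exchanging the roles of \<open>b\<close> and
    \<open>c\<close>.\<close>
  have *: "trace s (u \<circ> v) = (\<Sum>b\<in>B. \<Sum>c\<in>B. representation B (v b) c * representation B (u c) b)"
    if u: "u \<in> endos s" for u v
  proof -
    interpret u: Vector_Spaces.linear s s u using u by (simp add: endos_def)
    have "u (v b) = (\<Sum>c\<in>B. s (representation B (v b) c) (u c))" for b
      by (subst sum_representation_eq[OF B(1) _ B(3) order_refl, of "v b", symmetric])
        (simp_all add: B u.sum u.scale)
    then show ?thesis
      by (simp add: B representation_sum representation_scale)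
  qed
  show ?thesis
    unfolding *[OF assms(3)] *[OF assms(4)]
    by (subst sum.swap) (simp add: mult.commute)
qed

section \<open>The Yetter-Drinfeld setting and its Sweedler rules\<close>

locale yetter_drinfeld_setting =
  bijective_hopf_algebra H + A: yetter_drinfeld_algebra H scaleA actA coact +
  V: hopf_module H scaleV actV
  for H :: "('k::field, 'h::{ring, monoid_mult}) hopf_data"
    and scaleA :: "'k \<Rightarrow> 'a::{ring, monoid_mult} \<Rightarrow> 'a" and actA and coact
    and scaleV :: "'k \<Rightarrow> 'v::ab_group_add \<Rightarrow> 'v" and actV +
  assumes finite_dim_V: "finite_dim scaleV"
begin

abbreviation "Es \<equiv> endos scaleV"
abbreviation "es \<equiv> end_scale scaleV"
abbreviation "R a \<equiv> psum (sw (coact a))"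
abbreviation "tr \<equiv> trace scaleV"
abbreviation "bilinear \<equiv> bilin_on UNIV scaleA Es es ((*) :: 'k \<Rightarrow> 'k \<Rightarrow> 'k)"

lemma actV_endos: "actV h \<in> Es"
  by (simp add: endos_def V.act_linear)

lemma comp_endos: "u \<in> Es \<Longrightarrow> v \<in> Es \<Longrightarrow> u \<circ> v \<in> Es"
  by (simp add: endos_def Vector_Spaces.linear_compose)

lemma id_endos: "id \<in> Es"
  using V.vector_space by (simp add: endos_def Vector_Spaces.linear_iff)

lemma add_endos: "u \<in> Es \<Longrightarrow> v \<in> Es \<Longrightarrow> u + v \<in> Es"
  and zero_endos: "0 \<in> Es"
  and scale_endos: "u \<in> Es \<Longrightarrow> es c u \<in> Es"
proof -
  interpret vector_space scaleV by (rule V.vector_space)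
  show "u \<in> Es \<Longrightarrow> v \<in> Es \<Longrightarrow> u + v \<in> Es" "0 \<in> Es" "u \<in> Es \<Longrightarrow> es c u \<in> Es"
    using V.vector_space
    by (auto simp: endos_def Vector_Spaces.linear_iff end_scale_def scale_right_distrib algebra_simps
        zero_fun_def mult.commute)
qed

lemmas endos_intros = actV_endos comp_endos id_endos

lemma actV_mult: "actV (g * h) = actV g \<circ> actV h"
  by (auto simp: V.act_mult)

lemma actV_one: "actV 1 = id"
  by (auto simp: V.act_one)

lemma lin_actV: "lin_on UNIV hs es actV"
  by (auto simp: lin_on_def V.act_add V.act_scale end_scale_def)

lemma lin_comp_left: "lin_on C s es T \<Longrightarrow> lin_on C s es (\<lambda>x. T x \<circ> u)"
  by (auto simp: lin_on_def end_scale_def fun_eq_iff)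

lemma lin_comp_right: "u \<in> Es \<Longrightarrow> lin_on C s es T \<Longrightarrow> lin_on C s es (\<lambda>x. u \<circ> T x)"
  by (auto simp: lin_on_def end_scale_def fun_eq_iff endos_def Vector_Spaces.linear_iff)

lemma lin_actA: "lin_on C s hs T \<Longrightarrow> lin_on C s scaleA (\<lambda>x. actA (T x) a)"
  by (auto simp: lin_on_def A.act_add A.act_scale)

lemma lin_coact:
  fixes F :: "'a \<Rightarrow> 'h \<Rightarrow> 'k"
  assumes "lin_on C s scaleA T"
    and "\<And>y. lin_on UNIV scaleA (*) (\<lambda>x. F x y)" and "\<And>x. lin_on UNIV hs (*) (F x)"
  shows "lin_on C s (*) (\<lambda>x. R (T x) F)"
  by (rule lin_comp[OF linear_into_tensor_psum[OF A.coact_linear bilin_onI vector_space_field] assms(1)])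
    (use assms in auto)

lemmas lin_rules = lin_intros_inverse lin_comp[OF lin_actV] lin_comp_left lin_comp_right lin_actA
  lin_comp[OF linear_lin[OF A.act_linear]]
  lin_comp[OF lin_trace[OF V.vector_space finite_dim_V]]
  lin_on_mult_left[OF A.unital_algebra_axioms] lin_on_mult_right[OF A.unital_algebra_axioms]
  lin_on_sum_list_const[OF vector_space_field]
  lin_coact endos_intros

lemma bilinear_lin:
  assumes "bilinear L"
  shows "lin_on C s scaleA T \<Longrightarrow> w \<in> Es \<Longrightarrow> lin_on C s (*) (\<lambda>x. L (T x) w)"
    and "lin_on C s es U \<Longrightarrow> (\<And>x. x \<in> C \<Longrightarrow> U x \<in> Es) \<Longrightarrow> lin_on C s (*) (\<lambda>x. L a (U x))"
  using assms by (auto simp: bilin_on_def lin_on_def)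

lemma coact_coassoc_psum:
  fixes F :: "'a \<Rightarrow> 'h \<Rightarrow> 'h \<Rightarrow> 'k"
  assumes "\<And>y z. lin_on UNIV scaleA (*) (\<lambda>x. F x y z)" "\<And>x z. lin_on UNIV hs (*) (\<lambda>y. F x y z)"
      "\<And>x y. lin_on UNIV hs (*) (\<lambda>z. F x y z)"
  shows "R a (\<lambda>a0 a1. R a0 (\<lambda>x y. F x y a1)) = R a (\<lambda>a0 a1. D a1 (\<lambda>x y. F a0 x y))"
  using tensor3_eq_sum[OF A.coact_coassoc[of a] assms]
  unfolding sum_list_concat_pairs by (simp add: psum_def comp_def case_prod_unfold)

lemma coact_mult_psum:
  fixes F :: "'a \<Rightarrow> 'h \<Rightarrow> 'k"
  assumes "\<And>y. lin_on UNIV scaleA (*) (\<lambda>x. F x y)" and "\<And>x. lin_on UNIV hs (*) (F x)"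
  shows "R (a * b) F = R a (\<lambda>a0 a1. R b (\<lambda>b0 b1. F (a0 * b0) (b1 * a1)))"
  using psum_class[OF bilin_onI[of UNIV UNIV scaleA "(*)" F hs], OF assms] A.coact_mult by simp

lemma coact_one_psum:
  fixes F :: "'a \<Rightarrow> 'h \<Rightarrow> 'k"
  assumes "\<And>y. lin_on UNIV scaleA (*) (\<lambda>x. F x y)" and "\<And>x. lin_on UNIV hs (*) (F x)"
  shows "R 1 F = F 1 1"
  using psum_class[OF bilin_onI[of UNIV UNIV scaleA "(*)" F hs], OF assms, of "[(1, 1)]"] A.coact_one
  by simp

text \<open>One more leg p is split off in front, and the Yetter-Drinfeld condition for the
  remaining legs is multiplied on the right by J p. On its left-hand side the factor q * J p then
  collapses. The calculation runs from the right-hand side to the left.\<close>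

lemma coact_act_psum:
  fixes F :: "'a \<Rightarrow> 'h \<Rightarrow> 'k"
  assumes "\<And>y. lin_on UNIV scaleA (*) (\<lambda>x. F x y)" and "\<And>x. lin_on UNIV hs (*) (F x)"
  shows "R (actA h a) F =
    D h (\<lambda>p r. D r (\<lambda>q s. R a (\<lambda>a0 a1. F (actA q a0) (s * a1 * J p))))"
proof -
  note F = lin_comp[OF assms(1)] lin_comp[OF assms(2)]
  have YD: "D r (\<lambda>q s. R (actA s a) (\<lambda>x y. G x (y * q))) =
      D r (\<lambda>q s. R a (\<lambda>a0 a1. G (actA q a0) (s * a1)))"
    if "\<And>y. lin_on UNIV scaleA (*) (\<lambda>x. G x y)" and "\<And>x. lin_on UNIV hs (*) (G x)"
    for G :: "'a \<Rightarrow> 'h \<Rightarrow> 'k" and r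
    using arg_cong[OF A.yetter_drinfeld[where h = r and a = a], of "\<lambda>t. psum (sw t) G"]
      psum_class[OF bilin_onI[of UNIV UNIV scaleA "(*)" G hs], OF that] by simp
  have "D h (\<lambda>p r. D r (\<lambda>q s. R a (\<lambda>a0 a1. F (actA q a0) (s * a1 * J p)))) =
      D h (\<lambda>p r. D r (\<lambda>q s. R (actA s a) (\<lambda>x y. F x (y * q * J p))))"
    by (rule psum_cong, rule YD[symmetric]) (intro F lin_rules)+
  also have "\<dots> = D h (\<lambda>p r. D r (\<lambda>q s. R (actA s a) (\<lambda>x y. F x (y * (q * J p)))))"
    by (simp add: mult.assoc)
  also have "\<dots> = R (actA h a) (\<lambda>x y. F x (y * 1))"
    by (rule collapse_left[OF J_right_psum, where q = "(*)"]) (intro F lin_rules)+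
  finally show ?thesis by simp
qed

section \<open>The action on End(V) and the pullback along \<theta>\<close>

lemma end_act_psum: "end_act H actV h u = D h (\<lambda>x y. actV x \<circ> u \<circ> actV (S y))"
  by (simp add: end_act_def psum_def)

lemma end_act_endos:
  assumes "u \<in> Es"
  shows "end_act H actV h u \<in> Es"
proof -
  have "psum xs (\<lambda>x y. actV x \<circ> u \<circ> actV (S y)) \<in> Es" for xs
    using assms by (induction xs) (auto intro!: add_endos zero_endos endos_intros)
  then show ?thesis by (simp add: end_act_psum)
qed

lemma lin_end_act:
  assumes "lin_on Es es (*) K" and "u \<in> Es"
  shows "K (end_act H actV h u) = D h (\<lambda>x y. K (actV x \<circ> u \<circ> actV (S y)))"
  unfolding end_act_psum
  by (rule lin_on_psum[OF assms(1)]) (auto intro: zero_endos add_endos endos_intros assms(2))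

text \<open>The pullback of a bilinear form \<open>L\<close> along \<open>\<theta>\<close>.\<close>

definition theta :: "('a \<Rightarrow> ('v \<Rightarrow> 'v) \<Rightarrow> 'k) \<Rightarrow> 'a \<Rightarrow> ('v \<Rightarrow> 'v) \<Rightarrow> 'k" where
  "theta L a u = R a (\<lambda>a0 a1. L a0 (actV (S a1) \<circ> u))"

lemma bilinear_theta:
  assumes L: "bilinear L"
  shows "bilinear (theta L)"
  unfolding theta_def by (rule bilin_onI) (intro bilinear_lin[OF L] lin_rules; assumption)+

text \<open>Applying S to the coaction leg r a_1 J(p) gives p S(a_1) S(r). So p comes out on the
  left of the endomorphism, while S(r) stands before the leg x with which \<open>end_act\<close>
  starts; r and x are consecutive legs of h, and S(r) x cancels.\<close>

lemma theta_act:
  assumes L: "bilinear L" and u: "u \<in> Es"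
  shows "D h (\<lambda>h0 h1. theta L (actA h0 a) (end_act H actV h1 u)) =
    D h (\<lambda>p r. D r (\<lambda>q y. theta (\<lambda>a w. L (actA q a) (actV p \<circ> w \<circ> actV (S y))) a u))"
proof -
  note rules = bilinear_lin[OF L] lin_rules u
  \<comment> \<open>Each leg gets its own slot, so that linearity is proved once for each;
    \<open>z\<close> receives the product that will collapse to 1.\<close>
  define K where "K p q a0 a1 z y =
    L (actA q a0) (actV p \<circ> actV (S a1) \<circ> actV z \<circ> u \<circ> actV (S y))" for p q a0 a1 z y
  have K_lin: "lin_on C s (*) (\<lambda>x. K (T x) q a0 a1 z y)" "lin_on C s (*) (\<lambda>x. K p (T x) a0 a1 z y)"
    "lin_on C s (*) (\<lambda>x. K p q a0 (T x) z y)"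
    "lin_on C s (*) (\<lambda>x. K p q a0 a1 (T x) y)" "lin_on C s (*) (\<lambda>x. K p q a0 a1 z (T x))"
    if "lin_on C s hs T" for C s and T :: "'c::plus \<Rightarrow> 'h" and p q a0 a1 z y
    unfolding K_def by (intro rules that)+
  have "D h (\<lambda>h0 h1. theta L (actA h0 a) (end_act H actV h1 u)) =
      D h (\<lambda>h0 h1. R (actA h0 a) (\<lambda>x0 x1. D h1 (\<lambda>x y.
        L x0 (actV (S x1) \<circ> (actV x \<circ> u \<circ> actV (S y))))))"
    unfolding theta_def by (intro psum_cong lin_end_act rules)
  also have "\<dots> = D h (\<lambda>h0 h1. D h0 (\<lambda>p h'. D h' (\<lambda>q r. R a (\<lambda>a0 a1. D h1 (\<lambda>x y.
        L (actA q a0) (actV (S (r * a1 * J p)) \<circ> (actV x \<circ> u \<circ> actV (S y))))))))"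
    by (rule psum_cong, rule coact_act_psum) (intro rules)+
  also have "\<dots> = D h (\<lambda>h0 h1. D h0 (\<lambda>p h'. D h' (\<lambda>q r. R a (\<lambda>a0 a1. D h1 (\<lambda>x y.
        K p q a0 a1 (S r * x) y)))))"
    by (simp add: K_def antipode_mult actV_mult comp_assoc)
  also have "\<dots> = D h (\<lambda>p k. D k (\<lambda>h' h1. D h' (\<lambda>q r. R a (\<lambda>a0 a1. D h1 (\<lambda>x y.
        K p q a0 a1 (S r * x) y)))))"
    by (rule coassoc_psum[where q = "(*)"]) (intro K_lin lin_rules)+
  also have "\<dots> = D h (\<lambda>p k. D k (\<lambda>q k'. D k' (\<lambda>r h1. R a (\<lambda>a0 a1. D h1 (\<lambda>x y.
        K p q a0 a1 (S r * x) y)))))"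
    by (rule psum_cong, rule coassoc_psum[where q = "(*)"]) (intro K_lin lin_rules)+
  \<comment> \<open>The coaction sum stands between the adjacent legs \<open>r\<close> and
    \<open>x\<close>; it is moved outwards to expose the pattern of the collapse.\<close>
  also have "\<dots> = D h (\<lambda>p k. D k (\<lambda>q k'. R a (\<lambda>a0 a1. D k' (\<lambda>r h1. D h1 (\<lambda>x y.
        K p q a0 a1 (S r * x) y)))))"
    by (rule psum_cong, rule psum_cong, rule psum_swap)
  also have "\<dots> = D h (\<lambda>p k. D k (\<lambda>q k'. R a (\<lambda>a0 a1. K p q a0 a1 1 k')))"
    by (rule psum_cong, rule psum_cong, rule psum_cong,
        rule collapse_left[OF antipode_left_psum, where q = "(*)"]) (intro K_lin lin_rules)+
  finally show ?thesis by (simp add: K_def theta_def actV_one comp_assoc)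
qed

text \<open>The coaction of a product has its H-factors reversed, and S restores the order: S(x_1
  a_1) = S(a_1) S(x_1). The factor S(x_1) cancels the first leg of c_1 acting on u, and the last
  leg, entering through an antipode, is exactly the twist of v.\<close>

lemma theta_mult:
  assumes L: "bilinear L" and u: "u \<in> Es" and v: "v \<in> Es"
  shows "R c (\<lambda>c0 c1. theta L (a * c0) (end_act H actV c1 u \<circ> v)) =
    theta (\<lambda>a w. theta (\<lambda>a' w'. L (a * a') (w \<circ> w')) c v) a u"
proof -
  note rules = bilinear_lin[OF L] lin_rules u v
  define K where "K a0 a1 x0 z y =
    L (a0 * x0) (actV (S a1) \<circ> actV z \<circ> u \<circ> actV (S y) \<circ> v)" for a0 a1 x0 z y
  have K_lin: "lin_on C s (*) (\<lambda>x. K a0 a1 x0 (T x) y)" "lin_on C s (*) (\<lambda>x. K a0 a1 x0 z (T x))"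
    if "lin_on C s hs T" for C s and T :: "'c::plus \<Rightarrow> 'h" and a0 a1 x0 z y
    unfolding K_def by (intro rules that)+
  have K_lin': "lin_on UNIV scaleA (*) (\<lambda>x. K a0 a1 x z y)" for a0 a1 z y
    unfolding K_def by (intro rules)+
  have *: "lin_on Es es (*) (\<lambda>w. theta L x (w \<circ> v))" for x
    by (rule lin_on_comp[where G = "theta L x" and T = "\<lambda>w. w \<circ> v" and D = Es and s' = es])
      (use bilinear_theta[OF L] in \<open>auto simp: bilin_on_def intro!: lin_rules v\<close>)
  have "R c (\<lambda>c0 c1. theta L (a * c0) (end_act H actV c1 u \<circ> v)) =
      R c (\<lambda>c0 c1. D c1 (\<lambda>p q. theta L (a * c0) (actV p \<circ> u \<circ> actV (S q) \<circ> v)))"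
    by (rule psum_cong, rule lin_end_act[OF * u])
  also have "\<dots> = R c (\<lambda>c0 c1. D c1 (\<lambda>p q. R a (\<lambda>a0 a1. R c0 (\<lambda>x0 x1.
      L (a0 * x0) (actV (S (x1 * a1)) \<circ> (actV p \<circ> u \<circ> actV (S q) \<circ> v))))))"
    unfolding theta_def by (rule psum_cong, rule psum_cong, rule coact_mult_psum) (intro rules)+
  also have "\<dots> = R c (\<lambda>c0 c1. D c1 (\<lambda>p q. R a (\<lambda>a0 a1. R c0 (\<lambda>x0 x1.
      K a0 a1 x0 (S x1 * p) q))))"
    by (simp add: K_def antipode_mult actV_mult comp_assoc)
  also have "\<dots> = R c (\<lambda>c0 c1. R a (\<lambda>a0 a1. R c0 (\<lambda>x0 x1. D c1 (\<lambda>p q.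
      K a0 a1 x0 (S x1 * p) q))))"
    by (rule psum_cong, rule HOL.trans[OF psum_swap], rule psum_cong, rule psum_swap)
  also have "\<dots> = R a (\<lambda>a0 a1. R c (\<lambda>c0 c1. R c0 (\<lambda>x0 x1. D c1 (\<lambda>p q.
      K a0 a1 x0 (S x1 * p) q))))"
    by (rule psum_swap)
  \<comment> \<open>Coassociativity of the coaction makes \<open>x\<close> and \<open>p\<close>
    consecutive legs of a single element.\<close>
  also have "\<dots> = R a (\<lambda>a0 a1. R c (\<lambda>c0 c1. D c1 (\<lambda>x y. D y (\<lambda>p q.
      K a0 a1 c0 (S x * p) q))))"
    by (rule psum_cong, rule coact_coassoc_psum) (intro K_lin K_lin' lin_rules)+
  also have "\<dots> = R a (\<lambda>a0 a1. R c (\<lambda>c0 c1. K a0 a1 c0 1 c1))"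
    by (rule psum_cong, rule psum_cong,
        rule collapse_left[OF antipode_left_psum, where q = "(*)"]) (intro K_lin lin_rules)+
  finally show ?thesis by (simp add: K_def theta_def actV_one comp_assoc)
qed

lemma theta_one:
  assumes L: "bilinear L"
  shows "theta L 1 id = L 1 id"
proof -
  have "theta L 1 id = L 1 (actV (S 1) \<circ> id)"
    unfolding theta_def by (rule coact_one_psum) (intro bilinear_lin[OF L] lin_rules)+
  then show ?thesis by (simp add: antipode_one actV_one)
qed

end

section \<open>The algebra \<open>A \<otimes> End(V)\<close>\<close>

lemma sum_list_cong:
  "(\<And>x. x \<in> set xs \<Longrightarrow> F x = G x) \<Longrightarrow> (\<Sum>x\<leftarrow>xs. F x) = (\<Sum>x\<leftarrow>xs. G x)"
  by (metis map_cong)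

lemma sum_list_product_lists_Cons:
  "(\<Sum>ps\<leftarrow>product_lists (L # Ls). F ps) = (\<Sum>x\<leftarrow>L. \<Sum>ps\<leftarrow>product_lists Ls. F (x # ps))"
  by (induction L) (auto simp: comp_def)

lemma sum_product_lists_Cons:
  "(\<Sum>ps\<leftarrow>product_lists (L # Ls). F ps) = psum L (\<lambda>a w. \<Sum>ps\<leftarrow>product_lists Ls. F ((a, w) # ps))"
  by (induction L) (auto simp: comp_def)

lemma sum_product_lists_append:
  "(\<Sum>ps\<leftarrow>product_lists (Ks @ Ls). F ps) =
   (\<Sum>ps\<leftarrow>product_lists Ks. \<Sum>qs\<leftarrow>product_lists Ls. F (ps @ qs))"
  by (induction Ks arbitrary: F) (simp_all del: product_lists.simps(2) add: sum_list_product_lists_Cons)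

text \<open>The sum over one factor is brought outermost, which is where a statement about bilinear
  forms on that factor can be applied.\<close>

lemma sum_product_lists_slot:
  "(\<Sum>ps\<leftarrow>product_lists (Ks @ L # Ls). F ps) =
   psum L (\<lambda>a w. \<Sum>ps\<leftarrow>product_lists Ks. \<Sum>qs\<leftarrow>product_lists Ls. F (ps @ (a, w) # qs))"
  by (simp add: sum_product_lists_append sum_product_lists_Cons psum_sum_list_swap del: product_lists.simps)

lemma map2_append_Cons:
  assumes "length hs1 + length hs2 + 1 = length as"
  shows "map2 f (hs1 @ h # hs2) as = map2 f hs1 (take (length hs1) as) @
    f h (as ! length hs1) # map2 f hs2 (drop (Suc (length hs1)) as)"
proof -
  obtain A x B where as: "as = A @ x # B" and "length hs1 = length A"
    using assms id_take_nth_drop[of "length hs1" as] by fastforce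
  then show ?thesis by simp
qed

lemma length_iter_sweedler: "hs \<in> set (iter_sweedler H n h) \<Longrightarrow> length hs = Suc n"
  by (induction n arbitrary: h hs) auto

lemma foldr_comp_append: "foldr (\<circ>) us v = foldr (\<circ>) us id \<circ> v"
  by (induction us) (auto simp: fun_eq_iff)

lemma iter_sweedler_Suc_psum:
  "(\<Sum>hs\<leftarrow>iter_sweedler H (Suc n) h. F hs) =
   psum (sweedler H h) (\<lambda>h0 h1. \<Sum>hs\<leftarrow>iter_sweedler H n h1. F (h0 # hs))"
  by (simp add: sum_list_concat_pairs comp_def)

text \<open>Every stage of the iterated coproduct is linear, so linearity in each single position of
  the word suffices. The position must be arbitrary because the argument reaches all of
  them.\<close>

lemma (in hopf_algebra) lin_iter_sweedler:
  assumes "\<And>hs1 hs2. length hs1 + length hs2 = n \<Longrightarrow>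
      lin_on UNIV hs ((*) :: 'k \<Rightarrow> 'k \<Rightarrow> 'k) (\<lambda>h. X (hs1 @ h # hs2))"
  shows "lin_on UNIV hs (*) (\<lambda>h. \<Sum>ks\<leftarrow>iter_sweedler H n h. X ks)"
  using assms
proof (induction n arbitrary: X)
  case 0
  then show ?case using 0[of "[]" "[]"] by simp
next
  case (Suc n)
  have "lin_on UNIV hs (*) (\<lambda>h. D h (\<lambda>h0 h1. \<Sum>ks\<leftarrow>iter_sweedler H n h1. X (h0 # ks)))"
  proof (rule lin_sweedler[OF vector_space_field lin_on_id])
    show "lin_on UNIV hs (*) (\<lambda>x. \<Sum>ks\<leftarrow>iter_sweedler H n y. X (x # ks))" for y
      by (rule lin_on_sum_list_const[OF vector_space_field])
        (use Suc.prems[of "[]"] length_iter_sweedler in force)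
    show "lin_on UNIV hs (*) (\<lambda>h1. \<Sum>ks\<leftarrow>iter_sweedler H n h1. X (x # ks))" for x
      by (rule Suc.IH) (use Suc.prems[of "x # _"] in force)
  qed
  then show ?case by (simp only: iter_sweedler_Suc_psum)
qed

context yetter_drinfeld_setting
begin

section \<open>Operations of A \<otimes> End(V) on twisted representatives\<close>

abbreviation "N \<equiv> end_alg H scaleA actA coact scaleV actV"
abbreviation "M \<equiv> type_alg scaleA actA"
abbreviation "LE \<equiv> lists (UNIV \<times> Es) :: ('a \<times> ('v \<Rightarrow> 'v)) list set"

lemma car_N: "car N = end_class scaleA scaleV ` LE"
  by (simp add: end_alg_def end_class_def tensor_space_def)

text \<open>The relations stay inside words with endomorphism entries, since \<open>endos\<close> is
  closed under sums and scaling. Hence the unknown representative also has entries in End(V), where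
  the forms are linear.\<close>

lemma sw_end_class: "xs \<in> LE \<Longrightarrow> sw (end_class scaleA scaleV xs) \<in> LE"
proof -
  have "us \<in> LE \<and> vs \<in> LE" if "(us, vs) \<in> tensor_rels UNIV scaleA Es es" for us vs
    using that by (rule tensor_rels_lists) (auto intro: add_endos scale_endos)
  then show "xs \<in> LE \<Longrightarrow> sw (end_class scaleA scaleV xs) \<in> LE"
    unfolding end_class_def using formal_eq_lists[OF sw_tensor_class] by blast
qed

lemma sw_car: "b \<in> car N \<Longrightarrow> sw b \<in> LE"
  unfolding car_N using sw_end_class by auto

lemma sw_car_endos: "b \<in> car N \<Longrightarrow> (a, u) \<in> set (sw b) \<Longrightarrow> u \<in> Es"
  using sw_car[of b] by (auto simp: in_lists_conv_set)

text \<open>The map \<theta> on representatives, dual to its action \<open>theta\<close> on forms;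
  keeping a list allows \<theta> to be applied in all tensor factors at once through
  \<open>product_lists\<close>.\<close>

definition twist_list :: "('a \<times> ('v \<Rightarrow> 'v)) list \<Rightarrow> ('a \<times> ('v \<Rightarrow> 'v)) list" where
  "twist_list xs =
     concat (map (\<lambda>(a, u). map (\<lambda>(a0, a1). (a0, actV (S a1) \<circ> u)) (sw (coact a))) xs)"

abbreviation "twist b \<equiv> twist_list (sw b)"

lemma psum_twist_list: "psum (twist_list xs) L = psum xs (theta L)"
  by (simp add: twist_list_def theta_def[abs_def])

lemma twist_list_endos: "xs \<in> LE \<Longrightarrow> twist_list xs \<in> LE"
  by (induction xs) (auto simp: twist_list_def intro!: endos_intros)

lemma twist_endos: "b \<in> car N \<Longrightarrow> (a, w) \<in> set (twist b) \<Longrightarrow> w \<in> Es"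
  using twist_list_endos[OF sw_car[of b]] by (auto simp: in_lists_conv_set)

lemma psum_twist_class:
  assumes "bilinear L" and "xs \<in> LE"
  shows "psum (twist (end_class scaleA scaleV xs)) L = psum xs (theta L)"
  unfolding psum_twist_list end_class_def
  by (rule psum_class[OF bilinear_theta]) (use assms in auto)

lemma act_N_list: "b \<in> car N \<Longrightarrow>
    [(actA h0 a, end_act H actV h1 u). (a, u) \<leftarrow> sw b, (h0, h1) \<leftarrow> sweedler H h] \<in> LE"
  by (auto simp: in_lists_conv_set dest!: sw_car_endos intro!: end_act_endos)

lemma act_N_car: "b \<in> car N \<Longrightarrow> act N h b \<in> car N"
  by (subst car_N, drule act_N_list[of b h]) (simp add: end_alg_def)

lemma psum_twist_act:
  assumes L: "bilinear L" and b: "b \<in> car N"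
  shows "psum (twist (act N h b)) L = D h (\<lambda>p r. D r (\<lambda>q y.
    psum (twist b) (\<lambda>a w. L (actA q a) (actV p \<circ> w \<circ> actV (S y)))))"
proof -
  have "psum (twist (act N h b)) L =
      psum (sw b) (\<lambda>a u. D h (\<lambda>h0 h1. theta L (actA h0 a) (end_act H actV h1 u)))"
    using psum_twist_class[OF L act_N_list[OF b]] by (simp add: end_alg_def)
  also have "\<dots> = psum (sw b) (\<lambda>a u. D h (\<lambda>p r. D r (\<lambda>q y.
      theta (\<lambda>a w. L (actA q a) (actV p \<circ> w \<circ> actV (S y))) a u)))"
    by (rule psum_cong, rule theta_act[OF L sw_car_endos[OF b]])
  also have "\<dots> = D h (\<lambda>p r. D r (\<lambda>q y. psum (sw b) (\<lambda>a u.
      theta (\<lambda>a w. L (actA q a) (actV p \<circ> w \<circ> actV (S y))) a u)))"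
    by (rule HOL.trans[OF psum_swap], rule psum_cong, rule psum_swap)
  finally show ?thesis by (simp add: psum_twist_list)
qed

lemma mul_N_list: "b \<in> car N \<Longrightarrow> b' \<in> car N \<Longrightarrow>
    [(a * c0, end_act H actV c1 u \<circ> v). (a, u) \<leftarrow> sw b, (c, v) \<leftarrow> sw b', (c0, c1) \<leftarrow> sw (coact c)] \<in> LE"
  by (auto simp: in_lists_conv_set dest!: sw_car_endos)
    (fold comp_def, intro comp_endos end_act_endos)

lemma mul_N_car: "b \<in> car N \<Longrightarrow> b' \<in> car N \<Longrightarrow> mul N b b' \<in> car N"
  by (subst car_N, drule (1) mul_N_list[of b b']) (simp add: end_alg_def)

lemma psum_twist_mul:
  assumes L: "bilinear L" and b: "b \<in> car N" and b': "b' \<in> car N"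
  shows "psum (twist (mul N b b')) L =
    psum (twist b) (\<lambda>a w. psum (twist b') (\<lambda>a' w'. L (a * a') (w \<circ> w')))"
proof -
  have "psum (twist (mul N b b')) L =
      psum (sw b) (\<lambda>a u. psum (sw b') (\<lambda>c v. R c (\<lambda>c0 c1. theta L (a * c0) (end_act H actV c1 u \<circ> v))))"
    using psum_twist_class[OF L mul_N_list[OF b b']] by (simp add: end_alg_def)
  also have "\<dots> = psum (sw b) (\<lambda>a u. psum (sw b') (\<lambda>c v.
      theta (\<lambda>a w. theta (\<lambda>a' w'. L (a * a') (w \<circ> w')) c v) a u))"
    by (rule psum_cong, rule psum_cong, rule theta_mult[OF L sw_car_endos[OF b] sw_car_endos[OF b']])
  also have "\<dots> = psum (sw b) (\<lambda>a u. theta (\<lambda>a w. psum (sw b') (\<lambda>c v.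
      theta (\<lambda>a' w'. L (a * a') (w \<circ> w')) c v)) a u)"
    unfolding theta_def by (rule psum_cong, rule psum_swap)
  finally show ?thesis by (simp add: psum_twist_list)
qed

lemma unt_N_car: "unt N \<in> car N"
  unfolding car_N using id_endos by (auto simp: end_alg_def)

lemma psum_twist_unt:
  assumes L: "bilinear L"
  shows "psum (twist (unt N)) L = L 1 id"
  using psum_twist_class[OF L, of "[(1, id)]"] theta_one[OF L] id_endos by (simp add: end_alg_def)

lemma add_N_car: "b \<in> car N \<Longrightarrow> b' \<in> car N \<Longrightarrow> add N b b' \<in> car N"
  using sw_car[of b] sw_car[of b'] by (simp add: end_alg_def tensor_add_def tensor_space_def)

lemma psum_twist_add:
  assumes L: "bilinear L" and b: "b \<in> car N" and b': "b' \<in> car N"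
  shows "psum (twist (add N b b')) L = psum (twist b) L + psum (twist b') L"
  using psum_twist_class[OF L, of "sw b @ sw b'"] sw_car[OF b] sw_car[OF b']
  by (simp add: end_alg_def tensor_add_def end_class_def psum_twist_list)

lemma smul_N_list: "b \<in> car N \<Longrightarrow> [(scaleA c a, u). (a, u) \<leftarrow> sw b] \<in> LE"
  by (auto simp: in_lists_conv_set dest!: sw_car_endos)

lemma smul_N_car: "b \<in> car N \<Longrightarrow> smul N c b \<in> car N"
  using smul_N_list[of b c] by (simp add: end_alg_def tensor_scale_def tensor_space_def)

lemma psum_twist_smul:
  assumes L: "bilinear L" and b: "b \<in> car N"
  shows "psum (twist (smul N c b)) L = c * psum (twist b) L"
proof -
  have "psum (twist (smul N c b)) L = psum (sw b) (\<lambda>a u. theta L (scaleA c a) u)"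
    using psum_twist_class[OF L smul_N_list[OF b, of c]]
    by (simp add: end_alg_def tensor_scale_def end_class_def)
  also have "\<dots> = psum (sw b) (\<lambda>a u. c * theta L a u)"
    using bilinear_theta[OF L] sw_car_endos[OF b]
    by (auto intro!: psum_cong simp: bilin_on_def lin_on_def)
  finally show ?thesis by (simp add: psum_mult_left psum_twist_list)
qed

section \<open>Multilinear forms on words and the twisted formula for \<Psi>\<close>

lemma product_lists_twist:
  assumes "set bs \<subseteq> car N" and "ps \<in> set (product_lists (map twist bs))"
  shows "length ps = length bs" and "ps \<in> LE"
proof -
  show "length ps = length bs" using in_set_product_lists_length[OF assms(2)] by simp
  have "list_all2 (\<lambda>x b. x \<in> set (twist b)) ps bs"
    using assms(2) by (simp add: product_lists_set list_all2_map2)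
  then show "ps \<in> LE"
    using assms(1) by (induction rule: list_all2_induct) (auto dest: twist_endos)
qed

text \<open>Stated one slot at a time with a prefix and a suffix fixed, which is the shape in which
  the identities for a single tensor factor consume it. Words drawn from twisted representatives
  satisfy the restriction to \<open>LE\<close>.\<close>

definition multilinear_form :: "nat \<Rightarrow> (('a \<times> ('v \<Rightarrow> 'v)) list \<Rightarrow> 'k) \<Rightarrow> bool" where
  "multilinear_form n \<Phi> \<longleftrightarrow> (\<forall>ps\<in>LE. \<forall>qs\<in>LE. length ps + length qs + 1 = n \<longrightarrow>
     bilinear (\<lambda>a w. \<Phi> (ps @ (a, w) # qs)))"

lemma multilinear_formD:
  "multilinear_form n \<Phi> \<Longrightarrow> ps \<in> LE \<Longrightarrow> qs \<in> LE \<Longrightarrow> length ps + length qs + 1 = n \<Longrightarrow>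
   bilinear (\<lambda>a w. \<Phi> (ps @ (a, w) # qs))"
  unfolding multilinear_form_def by blast

lemma multilinear_form_Cons:
  assumes "multilinear_form (Suc n) \<Phi>" and "w \<in> Es"
  shows "multilinear_form n (\<lambda>ps. \<Phi> ((a, w) # ps))"
  unfolding multilinear_form_def using multilinear_formD[OF assms(1), of "(a, w) # _"] assms(2) by simp

lemma bilinear_sum_list:
  assumes "\<And>x. x \<in> set xs \<Longrightarrow> bilinear (\<lambda>a w. L a w x)"
  shows "bilinear (\<lambda>a w. \<Sum>x\<leftarrow>xs. L a w x)"
  by (rule bilin_onI; rule lin_on_sum_list_const[OF vector_space_field])
    (use assms in \<open>auto simp: bilin_on_def\<close>)

lemma multilinear_form_slot:
  assumes "multilinear_form n \<Phi>" and "set bs \<subseteq> car N" and "set cs \<subseteq> car N" and "length bs + length cs + 1 = n"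
  shows "bilinear (\<lambda>a w. \<Sum>ps\<leftarrow>product_lists (map twist bs).
    \<Sum>qs\<leftarrow>product_lists (map twist cs). \<Phi> (ps @ (a, w) # qs))"
  by (intro bilinear_sum_list multilinear_formD[OF assms(1)])
    (use assms in \<open>simp_all add: product_lists_twist\<close>)

text \<open>The summand of \<Psi> once the antipode twist has been absorbed into the word. The group
  of endomorphisms is composed down to \<open>id\<close> and kept apart from the factor g_0, ready
  for rotation under the trace.\<close>

definition Phi :: "('a list \<Rightarrow> 'h \<Rightarrow> 'k) \<Rightarrow> 'h \<Rightarrow> ('a \<times> ('v \<Rightarrow> 'v)) list \<Rightarrow> 'k" where
  "Phi f g ps = D g (\<lambda>g0 g1. f (map fst ps) g1 * tr (foldr (\<circ>) (map snd ps) id \<circ> actV g0))"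

lemma Psi_pure_eq:
  "Psi_pure H coact scaleV actV f aus g =
   (\<Sum>ps\<leftarrow>product_lists (map (\<lambda>p. twist_list [p]) aus). Phi f g ps)"
proof -
  \<comment> \<open>A choice of coaction terms is converted into the corresponding word of twisted
    pairs.\<close>
  let ?z = "\<lambda>xs aus. map2 (\<lambda>(a0, a1) (a, u). (a0, actV (S a1) \<circ> u)) xs aus"
  have *: "(\<Sum>xs\<leftarrow>product_lists (map (\<lambda>(a, u). sw (coact a)) aus). F (?z xs aus)) =
      (\<Sum>ps\<leftarrow>product_lists (map (\<lambda>p. twist_list [p]) aus). F ps)" for F :: "_ \<Rightarrow> 'k"
  proof (induction aus arbitrary: F)
    case Nil
    show ?case by simp
  next
    case (Cons p aus)
    obtain a u where p: "p = (a, u)" by (cases p)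
    show ?case
      by (simp add: p sum_product_lists_Cons psum_twist_list Cons[symmetric] theta_def comp_def
          del: product_lists.simps)
  qed
  \<comment> \<open>Equal lengths matter here, because \<open>map2\<close> truncates to the shorter
    list.\<close>
  have z: "map fst xs = map fst (?z xs aus)"
    "map2 (\<lambda>(a0, a1) (a, u). actV (S a1) \<circ> u) xs aus = map snd (?z xs aus)"
    if "length xs = length aus" for xs
    using that by (induction xs aus rule: list_induct2) auto
  have "Psi_pure H coact scaleV actV f aus g = D g (\<lambda>g0 g1.
      \<Sum>xs\<leftarrow>product_lists (map (\<lambda>(a, u). sw (coact a)) aus).
        f (map fst (?z xs aus)) g1 * tr (foldr (\<circ>) (map snd (?z xs aus)) id \<circ> actV g0))"
    unfolding Psi_pure_def psum_def[symmetric]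
  proof (intro psum_cong sum_list_cong)
    fix g0 g1 xs assume "xs \<in> set (product_lists (map (\<lambda>(a, u). sw (coact a)) aus))"
    then have l: "length xs = length aus" using in_set_product_lists_length by fastforce
    show "f (map fst xs) g1 * tr (foldr (\<circ>) (map2 (\<lambda>(a0, a1) (a, u). actV (S a1) \<circ> u) xs aus) (actV g0)) =
        f (map fst (?z xs aus)) g1 * tr (foldr (\<circ>) (map snd (?z xs aus)) id \<circ> actV g0)"
      unfolding z[OF l, symmetric] by (subst foldr_comp_append) (rule HOL.refl)
  qed
  also have "\<dots> = D g (\<lambda>g0 g1. \<Sum>ps\<leftarrow>product_lists (map (\<lambda>p. twist_list [p]) aus).
      f (map fst ps) g1 * tr (foldr (\<circ>) (map snd ps) id \<circ> actV g0))"
    by (rule psum_cong, rule *)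
  also have "\<dots> = (\<Sum>ps\<leftarrow>product_lists (map (\<lambda>p. twist_list [p]) aus). Phi f g ps)"
    unfolding Phi_def by (rule psum_sum_list_swap)
  finally show ?thesis .
qed

text \<open>Choosing a pure tensor from each representative and then a term of its coaction amounts
  to choosing one entry of each twisted representative.\<close>

lemma Psi_eq:
  assumes "bs \<in> tuples N (n + 1)"
  shows "Psi H scaleA actA coact scaleV actV n f bs g = (\<Sum>ps\<leftarrow>product_lists (map twist bs). Phi f g ps)"
proof -
  have "(\<Sum>aus\<leftarrow>product_lists (map sw bs). \<Sum>ps\<leftarrow>product_lists (map (\<lambda>p. twist_list [p]) aus). F ps) =
      (\<Sum>ps\<leftarrow>product_lists (map twist bs). F ps)" for F :: "_ \<Rightarrow> 'k"
  proof (induction bs arbitrary: F)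
    case Nil
    show ?case by simp
  next
    case (Cons b bs)
    show ?case
      by (simp add: sum_product_lists_Cons psum_twist_list Cons[symmetric] psum_sum_list_swap[symmetric]
          theta_def[abs_def] del: product_lists.simps)
  qed
  then show ?thesis using assms by (simp add: Psi_def Psi_pure_eq)
qed

lemma Psi_slot:
  assumes "bs @ b # cs \<in> tuples N (n + 1)"
  shows "Psi H scaleA actA coact scaleV actV n f (bs @ b # cs) g =
    psum (twist b) (\<lambda>a w. \<Sum>ps\<leftarrow>product_lists (map twist bs).
      \<Sum>qs\<leftarrow>product_lists (map twist cs). Phi f g (ps @ (a, w) # qs))"
  unfolding Psi_eq[OF assms] by (simp add: sum_product_lists_slot del: product_lists.simps)

end

section \<open>Equivariance\<close>

context yetter_drinfeld_setting
begin

section \<open>Cochains as multilinear forms, and \<Psi> on pure tensors\<close>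

abbreviation "W ps \<equiv> foldr (\<circ>) (map snd (ps :: ('a \<times> ('v \<Rightarrow> 'v)) list)) id"
abbreviation "PL bs \<equiv> product_lists (map twist bs)"
abbreviation "PSI \<equiv> Psi H scaleA actA coact scaleV actV"

lemma W_endos: "ps \<in> LE \<Longrightarrow> W ps \<in> Es"
  by (induction ps) (auto intro!: endos_intros)

lemma W_append: "W (ps @ qs) = W ps \<circ> W qs"
  using foldr_comp_append[of "map snd ps" "W qs"] by simp

lemma cochain_slot:
  assumes "multilinear_cochain H M n f" and "length as + length bs = n"
  shows "lin_on UNIV scaleA (*) (\<lambda>x. f (as @ x # bs) g)"
proof -
  \<comment> \<open>The entry 0 is a placeholder, overwritten by the list updates in the definition
    of multilinearity.\<close>
  have 1: "as @ 0 # bs \<in> tuples M (n + 1)" using assms(2) by (simp add: tuples_def type_alg_def)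
  have 2: "length as \<le> n" using assms(2) by simp
  show ?thesis
    using assms(1) 1 2 unfolding multilinear_cochain_def lin_on_def
    by (fastforce simp: type_alg_def)
qed

lemma cochain_lin:
  assumes "multilinear_cochain H M n f" and "length as = Suc n"
  shows "lin_on UNIV hs (*) (f as)"
  using assms by (intro linear_lin) (simp add: multilinear_cochain_def tuples_def type_alg_def)

lemma multilinear_form_Phi:
  assumes f: "multilinear_cochain H M n f"
  shows "multilinear_form (n + 1) (Phi f g)"
  unfolding multilinear_form_def
proof (intro ballI impI)
  fix ps qs :: "('a \<times> ('v \<Rightarrow> 'v)) list"
  assume ps: "ps \<in> LE" and qs: "qs \<in> LE" and l: "length ps + length qs + 1 = n + 1"
  have *: "Phi f g (ps @ (a, w) # qs) = D g (\<lambda>g0 g1. f (map fst ps @ a # map fst qs) g1 *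
      tr (W ps \<circ> w \<circ> W qs \<circ> actV g0))" for a w
    using W_append[of ps "(a, w) # qs"] by (simp add: Phi_def comp_assoc)
  have "lin_on UNIV scaleA (*) (\<lambda>x. f (map fst ps @ x # map fst qs) z)" for z
    using l by (intro cochain_slot[OF f]) simp
  then show "bilinear (\<lambda>a w. Phi f g (ps @ (a, w) # qs))"
    unfolding * by (intro bilin_onI lin_rules W_endos ps qs)
qed

text \<open>The value of \<open>sw\<close> on the class of a pure tensor may be a longer sum than
  the single pair. Multilinearity allows it to be replaced by that pair in one tensor factor after
  another.\<close>

lemma Psi_class:
  assumes f: "multilinear_cochain H M n f" and "length aus = n + 1"
    and aus: "\<forall>(a, u)\<in>set aus. u \<in> Es"
  shows "PSI n f (map (\<lambda>(a, u). end_class scaleA scaleV [(a, u)]) aus) g =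
    Psi_pure H coact scaleV actV f aus g"
proof -
  let ?c = "\<lambda>p. end_class scaleA scaleV [p]"
  have c: "(\<lambda>(a, u). end_class scaleA scaleV [(a, u)]) = ?c" by auto
  have car: "set (map ?c aus) \<subseteq> car N" if "\<forall>(a, u)\<in>set aus. u \<in> Es" for aus
    using that unfolding car_N by auto
  \<comment> \<open>The form is arbitrary because fixing the head of the word produces a new form on
    the tail.\<close>
  have "(\<Sum>ps\<leftarrow>PL (map ?c aus). \<Phi> ps) =
      (\<Sum>ps\<leftarrow>product_lists (map (\<lambda>p. twist_list [p]) aus). \<Phi> ps)"
    if "multilinear_form (length aus) \<Phi>" "\<forall>(a, u)\<in>set aus. u \<in> Es" for \<Phi>
    using that
  proof (induction aus arbitrary: \<Phi>)
    case Nil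
    show ?case by simp
  next
    case (Cons p aus)
    obtain a u where p: "p = (a, u)" by (cases p)
    have u: "[(a, u)] \<in> LE" using Cons.prems p by auto
    have "bilinear (\<lambda>a w. \<Sum>ps\<leftarrow>PL (map ?c aus). \<Phi> ((a, w) # ps))"
      using multilinear_form_slot[OF Cons.prems(1), of "[]" "map ?c aus"] car[of aus] Cons.prems(2) by simp
    from psum_twist_class[OF this u]
    have "(\<Sum>ps\<leftarrow>PL (map ?c (p # aus)). \<Phi> ps) =
        psum (twist_list [p]) (\<lambda>a w. \<Sum>ps\<leftarrow>PL (map ?c aus). \<Phi> ((a, w) # ps))"
      by (simp add: sum_product_lists_Cons psum_twist_list p del: product_lists.simps)
    also have "\<dots> = psum (twist_list [p])
        (\<lambda>a w. \<Sum>ps\<leftarrow>product_lists (map (\<lambda>p. twist_list [p]) aus). \<Phi> ((a, w) # ps))"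
    proof (rule psum_cong, rule Cons.IH)
      fix b w assume "(b, w) \<in> set (twist_list [p])"
      then have "w \<in> Es" using twist_list_endos[OF u] by (auto simp: p in_lists_conv_set)
      then show "multilinear_form (length aus) (\<lambda>ps. \<Phi> ((b, w) # ps))"
        using Cons.prems(1) by (intro multilinear_form_Cons) simp
    qed (use Cons.prems in auto)
    finally show ?case by (simp add: sum_product_lists_Cons del: product_lists.simps)
  qed
  note * = this[OF _ aus]
  have "map ?c aus \<in> tuples N (n + 1)" using assms(2) car[OF aus] by (simp add: tuples_def)
  then show ?thesis
    unfolding Psi_pure_eq c using *[of "Phi f g"] multilinear_form_Phi[OF f] assms(2) by (simp add: Psi_eq)
qed

text \<open>A function that sees the endomorphisms of a word only through their product, as the
  trace formula does. This makes it possible to absorb the first endomorphism into the form and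
  induct.\<close>

definition operator_form :: "nat \<Rightarrow> ('a list \<Rightarrow> ('v \<Rightarrow> 'v) \<Rightarrow> 'k) \<Rightarrow> bool" where
  "operator_form n G \<longleftrightarrow>
     (\<forall>as bs w. length as + length bs = n \<longrightarrow> w \<in> Es \<longrightarrow> lin_on UNIV scaleA (*) (\<lambda>a. G (as @ a # bs) w)) \<and>
     (\<forall>as. length as = Suc n \<longrightarrow> lin_on Es es (*) (G as))"

lemma operator_form_slot:
  "operator_form n G \<Longrightarrow> length as + length bs = n \<Longrightarrow> w \<in> Es \<Longrightarrow> lin_on UNIV scaleA (*) (\<lambda>a. G (as @ a # bs) w)"
  unfolding operator_form_def by blast

lemma operator_form_end:
  "operator_form n G \<Longrightarrow> length as = Suc n \<Longrightarrow> lin_on C s es U \<Longrightarrow> (\<And>x. x \<in> C \<Longrightarrow> U x \<in> Es) \<Longrightarrow>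
   lin_on C s (*) (\<lambda>x. G as (U x))"
  by (rule lin_on_comp[where D = Es and s' = es]) (auto simp: operator_form_def)

lemma operator_form_Cons:
  assumes "operator_form (Suc n) G" and w: "w \<in> Es"
  shows "operator_form n (\<lambda>as u. G (a # as) (w \<circ> u))"
  unfolding operator_form_def
proof (intro conjI allI impI)
  fix as bs :: "'a list" and u assume "length as + length bs = n" "u \<in> Es"
  then show "lin_on UNIV scaleA (*) (\<lambda>b. G (a # as @ b # bs) (w \<circ> u))"
    using operator_form_slot[OF assms(1), of "a # as" bs] w by (simp add: comp_endos)
next
  fix as :: "'a list" assume "length as = Suc n"
  then show "lin_on Es es (*) (\<lambda>u. G (a # as) (w \<circ> u))"
    by (intro operator_form_end[OF assms(1)] lin_rules w) simp_all
qed

lemma operator_form_iter: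
  assumes G: "operator_form n G" and w: "w \<in> Es" and l: "length as = Suc n"
  shows "lin_on UNIV hs (*) (\<lambda>h. \<Sum>ks\<leftarrow>iter_sweedler H n h. G (map2 actA ks as) w)"
proof (rule lin_iter_sweedler)
  fix hs1 hs2 :: "'h list" assume k: "length hs1 + length hs2 = n"
  then have *: "map2 actA (hs1 @ h # hs2) as = map2 actA hs1 (take (length hs1) as) @
      actA h (as ! length hs1) # map2 actA hs2 (drop (Suc (length hs1)) as)" for h
    using l by (intro map2_append_Cons) simp
  show "lin_on UNIV hs (*) (\<lambda>h. G (map2 actA (hs1 @ h # hs2) as) w)"
    unfolding * by (rule lin_comp[OF operator_form_slot[OF G]]) (use k l w in \<open>auto intro!: lin_rules\<close>)
qed

text \<open>The induction hypothesis is applied to all factors but the first, for the form that has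
  absorbed the first endomorphism; only then is the action on the first factor expanded. Of h there
  remain p on the far left, S(y) on the far right, and a middle leg distributed over the
  A-components.\<close>

lemma sum_twist_act:
  assumes "operator_form n G" and "length bs = Suc n" and "set bs \<subseteq> car N"
  shows "(\<Sum>ks\<leftarrow>iter_sweedler H n h. \<Sum>ps\<leftarrow>PL (map2 (act N) ks bs). G (map fst ps) (W ps)) =
    D h (\<lambda>p r. D r (\<lambda>q y. \<Sum>ps\<leftarrow>PL bs. \<Sum>ks\<leftarrow>iter_sweedler H n q.
      G (map2 actA ks (map fst ps)) (actV p \<circ> W ps \<circ> actV (S y))))"
  using assms
proof (induction n arbitrary: G bs h)
  case 0
  then obtain b where bs: "bs = [b]" and b: "b \<in> car N" by (auto simp: length_Suc_conv)
  have "bilinear (\<lambda>a w. G [a] w)"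
    using operator_form_slot[OF 0(1), of "[]" "[]"] operator_form_end[OF 0(1) _ lin_on_id] by (auto intro!: bilin_onI)
  from psum_twist_act[OF this b]
  show ?case by (simp add: bs sum_product_lists_Cons comp_def del: product_lists.simps(2))
next
  case (Suc n)
  note G = Suc.prems(1)
  obtain b bs' where bs: "bs = b # bs'" and b: "b \<in> car N" and bs': "set bs' \<subseteq> car N"
    and l: "length bs' = Suc n"
    using Suc.prems by (auto simp: length_Suc_conv)
  have PL: "length ps = Suc n" "W ps \<in> Es" if "ps \<in> set (PL bs')" for ps
    using product_lists_twist[OF bs' that] l W_endos by auto
  \<comment> \<open>The slots follow the word: \<open>p\<close> on the left, \<open>q\<close> on the
    first A-component, \<open>z\<close> in the gap after the first endomorphism, \<open>q'\<close>
    on the remaining A-components, \<open>y'\<close> on the right.\<close>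
  define K where "K p q z q' y' = psum (twist b) (\<lambda>a w. \<Sum>ps\<leftarrow>PL bs'. \<Sum>ks\<leftarrow>iter_sweedler H n q'.
      G (actA q a # map2 actA ks (map fst ps)) (actV p \<circ> w \<circ> actV z \<circ> W ps \<circ> actV (S y')))" for p q z q' y'
  have iter: "length ks = Suc n" if "ks \<in> set (iter_sweedler H n q)" for ks q
    using length_iter_sweedler[OF that] .
  note sums = lin_on_psum_const[OF vector_space_field] lin_on_sum_list_const[OF vector_space_field]
  have G1: "lin_on C s (*) (\<lambda>x. G (T x # as) w)"
    if "lin_on C s scaleA T" "length as = Suc n" "w \<in> Es" for C s as w and T :: "'c::plus \<Rightarrow> 'a"
    using lin_comp[OF operator_form_slot[OF G, of "[]" as w] that(1)] that by simp
  have K1: "lin_on UNIV hs (*) (\<lambda>x. K x q z q' y')" for q z q' y'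
    unfolding K_def
    by (intro sums operator_form_end[OF G] lin_rules) (simp_all add: iter PL twist_endos[OF b] endos_intros)
  have K2: "lin_on UNIV hs (*) (\<lambda>x. K p x z q' y')" for p z q' y'
    unfolding K_def
    by (intro sums G1 lin_rules) (simp_all add: iter PL twist_endos[OF b] endos_intros)
  have K3: "lin_on UNIV hs (*) (\<lambda>x. K p q x q' y')" for p q q' y'
    unfolding K_def
    by (intro sums operator_form_end[OF G] lin_rules) (simp_all add: iter PL twist_endos[OF b] endos_intros)
  have K4: "lin_on UNIV hs (*) (\<lambda>x. K p q z x y')" for p q z y'
    unfolding K_def
  proof (intro sums)
    fix a w ps assume "(a, w) \<in> set (twist b)" and ps: "ps \<in> set (PL bs')"
    then have w: "w \<in> Es" using twist_endos[OF b] by auto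
    have "lin_on UNIV hs (*) (\<lambda>x. \<Sum>ks\<leftarrow>iter_sweedler H n x. G (actA q a # map2 actA ks (map fst ps))
        ((actV p \<circ> w \<circ> actV z) \<circ> (W ps \<circ> actV (S y'))))"
      by (rule operator_form_iter[OF operator_form_Cons[OF G]]) (simp_all add: w PL[OF ps] endos_intros)
    then show "lin_on UNIV hs (*) (\<lambda>x. \<Sum>ks\<leftarrow>iter_sweedler H n x. G (actA q a # map2 actA ks (map fst ps))
        (actV p \<circ> w \<circ> actV z \<circ> W ps \<circ> actV (S y')))"
      by (simp only: comp_assoc)
  qed
  have K5: "lin_on UNIV hs (*) (\<lambda>x. K p q z q' x)" for p q z q'
    unfolding K_def
    by (intro sums operator_form_end[OF G] lin_rules) (simp_all add: iter PL twist_endos[OF b] endos_intros)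
  note K_lin = lin_comp[OF K1] lin_comp[OF K2] lin_comp[OF K3] lin_comp[OF K4] lin_comp[OF K5]
  \<comment> \<open>This is the form left by the induction hypothesis; its bilinearity in the first
    factor permits expanding the action there.\<close>
  have bil: "bilinear (\<lambda>a w. D h1 (\<lambda>p' r'. D r' (\<lambda>q' y'. \<Sum>ps\<leftarrow>PL bs'. \<Sum>ks\<leftarrow>iter_sweedler H n q'.
      G (a # map2 actA ks (map fst ps)) (w \<circ> (actV p' \<circ> W ps \<circ> actV (S y'))))))" for h1
  proof (rule bilin_onI)
    fix w assume "w \<in> Es"
    then show "lin_on UNIV scaleA (*) (\<lambda>a. D h1 (\<lambda>p' r'. D r' (\<lambda>q' y'. \<Sum>ps\<leftarrow>PL bs'. \<Sum>ks\<leftarrow>iter_sweedler H n q'.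
        G (a # map2 actA ks (map fst ps)) (w \<circ> (actV p' \<circ> W ps \<circ> actV (S y'))))))"
      by (intro sums G1 lin_on_id endos_intros) (simp_all add: iter PL)
  next
    fix a
    show "lin_on Es es (*) (\<lambda>w. D h1 (\<lambda>p' r'. D r' (\<lambda>q' y'. \<Sum>ps\<leftarrow>PL bs'. \<Sum>ks\<leftarrow>iter_sweedler H n q'.
        G (a # map2 actA ks (map fst ps)) (w \<circ> (actV p' \<circ> W ps \<circ> actV (S y'))))))"
      by (intro sums operator_form_end[OF G] lin_comp_left lin_on_id endos_intros) (simp_all add: iter PL)
  qed
  have "(\<Sum>ks\<leftarrow>iter_sweedler H (Suc n) h. \<Sum>ps\<leftarrow>PL (map2 (act N) ks bs). G (map fst ps) (W ps)) =
      D h (\<lambda>h0 h1. psum (twist (act N h0 b)) (\<lambda>a w. \<Sum>ks\<leftarrow>iter_sweedler H n h1.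
        \<Sum>ps\<leftarrow>PL (map2 (act N) ks bs'). G (a # map fst ps) (w \<circ> W ps)))"
    unfolding iter_sweedler_Suc_psum bs
    by (simp add: sum_product_lists_Cons psum_sum_list_swap del: product_lists.simps)
  also have "\<dots> = D h (\<lambda>h0 h1. psum (twist (act N h0 b)) (\<lambda>a w. D h1 (\<lambda>p' r'. D r' (\<lambda>q' y'.
      \<Sum>ps\<leftarrow>PL bs'. \<Sum>ks\<leftarrow>iter_sweedler H n q'.
        G (a # map2 actA ks (map fst ps)) (w \<circ> (actV p' \<circ> W ps \<circ> actV (S y')))))))"
    by (rule psum_cong, rule psum_cong,
        rule Suc.IH[OF operator_form_Cons[OF G twist_endos[OF act_N_car[OF b]]] l bs'])
  also have "\<dots> = D h (\<lambda>h0 h1. D h0 (\<lambda>p r. D r (\<lambda>q y. psum (twist b) (\<lambda>a w. D h1 (\<lambda>p' r'. D r' (\<lambda>q' y'.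
      \<Sum>ps\<leftarrow>PL bs'. \<Sum>ks\<leftarrow>iter_sweedler H n q'. G (actA q a # map2 actA ks (map fst ps))
        (actV p \<circ> w \<circ> actV (S y) \<circ> (actV p' \<circ> W ps \<circ> actV (S y')))))))))"
    by (rule psum_cong, rule psum_twist_act[OF bil b])
  also have "\<dots> = D h (\<lambda>h0 h1. D h0 (\<lambda>p r. D r (\<lambda>q y. D h1 (\<lambda>p' r'. D r' (\<lambda>q' y'. psum (twist b) (\<lambda>a w.
      \<Sum>ps\<leftarrow>PL bs'. \<Sum>ks\<leftarrow>iter_sweedler H n q'. G (actA q a # map2 actA ks (map fst ps))
        (actV p \<circ> w \<circ> actV (S y) \<circ> (actV p' \<circ> W ps \<circ> actV (S y')))))))))"
    by (rule psum_cong, rule psum_cong, rule psum_cong, rule HOL.trans[OF psum_swap],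
        rule psum_cong, rule psum_swap)
  also have "\<dots> = D h (\<lambda>h0 h1. D h0 (\<lambda>p r. D r (\<lambda>q y. D h1 (\<lambda>p' r'. D r' (\<lambda>q' y'. K p q (S y * p') q' y')))))"
    by (simp add: K_def actV_mult comp_assoc)
  also have "\<dots> = D h (\<lambda>p k. D k (\<lambda>r h1. D r (\<lambda>q y. D h1 (\<lambda>p' r'. D r' (\<lambda>q' y'. K p q (S y * p') q' y')))))"
    by (rule coassoc_psum[where q = "(*)"]) (intro K_lin lin_intros)+
  also have "\<dots> = D h (\<lambda>p k. D k (\<lambda>q k'. D k' (\<lambda>y h1. D h1 (\<lambda>p' r'. D r' (\<lambda>q' y'. K p q (S y * p') q' y')))))"
    by (rule psum_cong, rule coassoc_psum[where q = "(*)"]) (intro K_lin lin_intros)+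
  \<comment> \<open>The closing S(y) of the first factor cancels the opening p' of the rest.\<close>
  also have "\<dots> = D h (\<lambda>p k. D k (\<lambda>q k'. D k' (\<lambda>q' y'. K p q 1 q' y')))"
    by (rule psum_cong, rule psum_cong, rule collapse_left[OF antipode_left_psum, where q = "(*)"])
      (intro K_lin lin_intros)+
  \<comment> \<open>The legs acting on the first and on the later A-components are regrouped as
    \<Delta>(k), the first stage of the iterated coproduct of k.\<close>
  also have "\<dots> = D h (\<lambda>p r. D r (\<lambda>k y'. D k (\<lambda>q q'. K p q 1 q' y')))"
    by (rule psum_cong, rule coassoc_psum[where q = "(*)", symmetric]) (intro K_lin lin_intros)+
  also have "\<dots> = D h (\<lambda>p r. D r (\<lambda>q y. \<Sum>ps\<leftarrow>PL bs. \<Sum>ks\<leftarrow>iter_sweedler H (Suc n) q.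
      G (map2 actA ks (map fst ps)) (actV p \<circ> W ps \<circ> actV (S y))))"
  proof (rule psum_cong, rule psum_cong)
    fix p r k y
    have "D k (\<lambda>q q'. K p q 1 q' y) = psum (twist b) (\<lambda>a w. D k (\<lambda>q q'. \<Sum>ps\<leftarrow>PL bs'. \<Sum>ks\<leftarrow>iter_sweedler H n q'.
      G (actA q a # map2 actA ks (map fst ps)) (actV p \<circ> w \<circ> actV 1 \<circ> W ps \<circ> actV (S y))))"
      unfolding K_def by (rule psum_swap)
    also have "\<dots> = psum (twist b) (\<lambda>a w. \<Sum>ps\<leftarrow>PL bs'. D k (\<lambda>q q'. \<Sum>ks\<leftarrow>iter_sweedler H n q'.
      G (actA q a # map2 actA ks (map fst ps)) (actV p \<circ> w \<circ> actV 1 \<circ> W ps \<circ> actV (S y))))"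
      by (rule psum_cong, rule psum_sum_list_swap)
    also have "\<dots> = (\<Sum>ps\<leftarrow>PL bs. \<Sum>ks\<leftarrow>iter_sweedler H (Suc n) k.
      G (map2 actA ks (map fst ps)) (actV p \<circ> W ps \<circ> actV (S y)))"
      unfolding iter_sweedler_Suc_psum bs
      by (simp add: sum_product_lists_Cons actV_one comp_assoc del: product_lists.simps)
    finally show "D k (\<lambda>q q'. K p q 1 q' y) = (\<Sum>ps\<leftarrow>PL bs. \<Sum>ks\<leftarrow>iter_sweedler H (Suc n) k.
      G (map2 actA ks (map fst ps)) (actV p \<circ> W ps \<circ> actV (S y)))" .
  qed
  finally show ?case .
qed

end

section \<open>The morphism of cocyclic modules\<close>

text \<open>Rotating first and then multiplying the two leading entries gives the last coface.
  Closure of the carrier under the action keeps the rotated tuple where the zeroth coface has not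
  been set to 0.\<close>

lemma coface_last:
  assumes "\<And>h b. b \<in> car X \<Longrightarrow> act X h b \<in> car X"
  shows "coface H X (Suc n) (Suc n) f = cyclic_op H X (Suc n) (coface H X (Suc n) 0 f)"
proof (intro ext)
  fix as g
  show "coface H X (Suc n) (Suc n) f as g = cyclic_op H X (Suc n) (coface H X (Suc n) 0 f) as g"
  proof (cases "as \<in> tuples X (Suc n + 1)")
    case False
    then show ?thesis by (simp add: coface_def cyclic_op_def)
  next
    case True
    then obtain a bs where "as = a # bs" and "length bs = Suc n"
      by (auto simp: tuples_def length_Suc_conv)
    then obtain cs b where as: "as = a # cs @ [b]" and l: "length cs = n"
      by (cases bs rule: rev_cases) auto
    have "act X h b # a # cs \<in> tuples X (Suc n + 1)" for h
      using True assms by (auto simp: as tuples_def)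
    then have "coface H X (Suc n) 0 f (act X h b # a # cs) = f (mul X (act X h b) a # cs)" for h
      by (intro ext) (simp add: coface_def)
    then show ?thesis
      using True l by (simp add: as coface_def cyclic_op_def nth_append)
  qed
qed

context yetter_drinfeld_setting
begin

section \<open>\<Psi> preserves multilinearity and equivariance\<close>

lemma Psi_multilinear:
  assumes f: "multilinear_cochain H M n f"
  shows "multilinear_cochain H N n (PSI n f)"
  unfolding multilinear_cochain_def
proof (intro conjI allI impI ballI)
  fix bs assume "bs \<notin> tuples N (n + 1)"
  then show "PSI n f bs = (\<lambda>g. 0)" by (simp add: Psi_def fun_eq_iff)
next
  fix bs assume bs: "bs \<in> tuples N (n + 1)"
  have *: "lin_on UNIV hs (*) (f (map fst ps))" "W ps \<in> Es" if "ps \<in> set (PL bs)" for ps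
    using product_lists_twist[OF _ that] bs by (auto simp: tuples_def intro!: cochain_lin[OF f] W_endos)
  have "lin_on UNIV hs (*) (PSI n f bs)"
    unfolding Psi_eq[OF bs, abs_def] Phi_def
    by (intro lin_on_sum_list_const[OF vector_space_field] lin_sweedler[OF vector_space_field] lin_rules)
      (simp_all add: *)
  then show "Vector_Spaces.linear hs (*) (PSI n f bs)"
    by (rule lin_linear[OF vector_space_hs vector_space_field])
next
  fix bs i x y g assume bs: "bs \<in> tuples N (n + 1)" and i: "i \<le> n" and x: "x \<in> car N" and y: "y \<in> car N"
  have i': "i < length bs" using bs i by (simp add: tuples_def)
  have t: "take i bs @ z # drop (Suc i) bs \<in> tuples N (n + 1)" if "z \<in> car N" for z
    using bs i that by (auto simp: tuples_def dest: in_set_takeD in_set_dropD)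
  have bil: "bilinear (\<lambda>a w. \<Sum>ps\<leftarrow>PL (take i bs). \<Sum>qs\<leftarrow>PL (drop (Suc i) bs). Phi f g (ps @ (a, w) # qs))"
    using bs i by (intro multilinear_form_slot[OF multilinear_form_Phi[OF f]]) (auto simp: tuples_def dest: in_set_takeD in_set_dropD)
  show "PSI n f (bs[i := add N x y]) g = PSI n f (bs[i := x]) g + PSI n f (bs[i := y]) g"
    unfolding upd_conv_take_nth_drop[OF i'] Psi_slot[OF t[OF x]] Psi_slot[OF t[OF y]]
      Psi_slot[OF t[OF add_N_car[OF x y]]]
    by (rule psum_twist_add[OF bil x y])
next
  fix bs i c x g assume bs: "bs \<in> tuples N (n + 1)" and i: "i \<le> n" and x: "x \<in> car N"
  have i': "i < length bs" using bs i by (simp add: tuples_def)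
  have t: "take i bs @ z # drop (Suc i) bs \<in> tuples N (n + 1)" if "z \<in> car N" for z
    using bs i that by (auto simp: tuples_def dest: in_set_takeD in_set_dropD)
  have bil: "bilinear (\<lambda>a w. \<Sum>ps\<leftarrow>PL (take i bs). \<Sum>qs\<leftarrow>PL (drop (Suc i) bs). Phi f g (ps @ (a, w) # qs))"
    using bs i by (intro multilinear_form_slot[OF multilinear_form_Phi[OF f]]) (auto simp: tuples_def dest: in_set_takeD in_set_dropD)
  show "PSI n f (bs[i := smul N c x]) g = c * PSI n f (bs[i := x]) g"
    unfolding upd_conv_take_nth_drop[OF i'] Psi_slot[OF t[OF x]] Psi_slot[OF t[OF smul_N_car[OF x]]]
    by (rule psum_twist_smul[OF bil x])
qed

text \<open>Since S reverses the coproduct, the legs of h nest: the outer pair p, y conjugates g_0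
  and the inner pair x, z conjugates g_1. The trace produces the outer conjugation, and equivariance
  of the cochain the inner one.\<close>

lemma comult_conj_psum:
  fixes F :: "'h \<Rightarrow> 'h \<Rightarrow> 'k"
  assumes "\<And>y. lin_on UNIV hs (*) (\<lambda>x. F x y)" and "\<And>x. lin_on UNIV hs (*) (F x)"
  shows "D (S h1 * g * h0) F = D h0 (\<lambda>p x. D h1 (\<lambda>z y. D g (\<lambda>g0 g1. F (S y * g0 * p) (S z * g1 * x))))"
proof -
  note F = lin_comp[OF assms(1)] lin_comp[OF assms(2)]
  have "D (S h1 * g * h0) F = D (S h1 * g) (\<lambda>k0 k1. D h0 (\<lambda>p x. F (k0 * p) (k1 * x)))"
    by (rule comult_mult_psum[OF assms])
  also have "\<dots> = D (S h1) (\<lambda>s0 s1. D g (\<lambda>g0 g1. D h0 (\<lambda>p x. F (s0 * g0 * p) (s1 * g1 * x))))"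
    by (rule comult_mult_psum[where q = "(*)"]) (intro F lin_intros)+
  also have "\<dots> = D h1 (\<lambda>z y. D g (\<lambda>g0 g1. D h0 (\<lambda>p x. F (S y * g0 * p) (S z * g1 * x))))"
    by (rule comult_antipode_psum) (intro F lin_intros)+
  also have "\<dots> = D h1 (\<lambda>z y. D h0 (\<lambda>p x. D g (\<lambda>g0 g1. F (S y * g0 * p) (S z * g1 * x))))"
    by (rule psum_cong, rule psum_swap)
  also have "\<dots> = D h0 (\<lambda>p x. D h1 (\<lambda>z y. D g (\<lambda>g0 g1. F (S y * g0 * p) (S z * g1 * x))))"
    by (rule psum_swap)
  finally show ?thesis .
qed

lemma trace_cycle: "u \<in> Es \<Longrightarrow> v \<in> Es \<Longrightarrow> tr (u \<circ> v) = tr (v \<circ> u)"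
  by (rule trace_comp_commute[OF V.vector_space finite_dim_V])

lemma Psi_equivariant:
  assumes f: "f \<in> cochains H M n" and bs: "bs \<in> tuples N (n + 1)"
  shows "(\<Sum>ks\<leftarrow>iter_sweedler H n h. PSI n f (map2 (act N) ks bs) g) =
    D h (\<lambda>h0 h1. PSI n f bs (S h1 * g * h0))"
proof -
  have ml: "multilinear_cochain H M n f" using f by (simp add: cochains_def)
  have eq: "(\<Sum>ks\<leftarrow>iter_sweedler H n q. f (map2 actA ks as) z) = D q (\<lambda>x y. f as (S y * z * x))"
    if "length as = Suc n" for as q z
    using f that by (simp add: cochains_def tuples_def type_alg_def psum_def)
  have l: "length bs = Suc n" and car: "set bs \<subseteq> car N" using bs by (auto simp: tuples_def)
  have PL: "length (map fst ps) = Suc n" "W ps \<in> Es" if "ps \<in> set (PL bs)" for ps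
    using product_lists_twist[OF car that] l W_endos by auto
  define G where "G as w = D g (\<lambda>g0 g1. f as g1 * tr (w \<circ> actV g0))" for as w
  have G: "operator_form n G"
    unfolding operator_form_def G_def
    by (intro conjI allI impI lin_rules lin_comp[OF cochain_slot[OF ml]])
  \<comment> \<open>The common form of both sides, with the four legs of h ordered as p, x, z,
    y.\<close>
  define X where "X ps p x z y = D g (\<lambda>g0 g1. f (map fst ps) (S z * g1 * x) *
      tr (W ps \<circ> actV (S y * g0 * p)))" for ps p x z y
  have X_lin: "lin_on C s (*) (\<lambda>t. X ps (T t) x z y)" "lin_on C s (*) (\<lambda>t. X ps p (T t) z y)"
    "lin_on C s (*) (\<lambda>t. X ps p x (T t) y)" "lin_on C s (*) (\<lambda>t. X ps p x z (T t))"
    if "lin_on C s hs T" "ps \<in> set (PL bs)" for C s and T :: "'c::plus \<Rightarrow> 'h" and ps p x z y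
    unfolding X_def
    by (intro lin_rules lin_comp[OF cochain_lin[OF ml PL(1)[OF that(2)]]] PL(2)[OF that(2)] that(1))+
  have "(\<Sum>ks\<leftarrow>iter_sweedler H n h. PSI n f (map2 (act N) ks bs) g) =
      (\<Sum>ks\<leftarrow>iter_sweedler H n h. \<Sum>ps\<leftarrow>PL (map2 (act N) ks bs). G (map fst ps) (W ps))"
  proof (rule sum_list_cong)
    fix ks assume "ks \<in> set (iter_sweedler H n h)"
    then have "map2 (act N) ks bs \<in> tuples N (n + 1)"
      using length_iter_sweedler[of ks H n h] l car
      by (auto simp: tuples_def dest!: set_zip_rightD intro!: act_N_car)
    from Psi_eq[OF this]
    show "PSI n f (map2 (act N) ks bs) g = (\<Sum>ps\<leftarrow>PL (map2 (act N) ks bs). G (map fst ps) (W ps))"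
      by (simp add: Phi_def G_def)
  qed
  also have "\<dots> = D h (\<lambda>p r. D r (\<lambda>q y. \<Sum>ps\<leftarrow>PL bs. \<Sum>ks\<leftarrow>iter_sweedler H n q.
      G (map2 actA ks (map fst ps)) (actV p \<circ> W ps \<circ> actV (S y))))"
    by (rule sum_twist_act[OF G l car])
  also have "\<dots> = D h (\<lambda>p r. D r (\<lambda>q y. \<Sum>ps\<leftarrow>PL bs. D q (\<lambda>x z. X ps p x z y)))"
  proof (intro psum_cong sum_list_cong)
    fix p r q y ps assume ps: "ps \<in> set (PL bs)"
    \<comment> \<open>Cyclicity moves the leftmost leg p behind g_0, completing the
      conjugation.\<close>
    have tr: "tr (actV p \<circ> W ps \<circ> actV (S y) \<circ> actV g0) = tr (W ps \<circ> actV (S y * g0 * p))" for g0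
      using trace_cycle[of "actV p" "W ps \<circ> actV (S y) \<circ> actV g0"] PL(2)[OF ps]
      by (simp add: endos_intros actV_mult comp_assoc)
    have "(\<Sum>ks\<leftarrow>iter_sweedler H n q. G (map2 actA ks (map fst ps)) (actV p \<circ> W ps \<circ> actV (S y))) =
        D g (\<lambda>g0 g1. \<Sum>ks\<leftarrow>iter_sweedler H n q. f (map2 actA ks (map fst ps)) g1 * tr (W ps \<circ> actV (S y * g0 * p)))"
      unfolding G_def tr by (rule psum_sum_list_swap[symmetric])
    also have "\<dots> = D g (\<lambda>g0 g1. D q (\<lambda>x z. f (map fst ps) (S z * g1 * x) * tr (W ps \<circ> actV (S y * g0 * p))))"
      by (rule psum_cong) (simp only: sum_list_mult_const eq[OF PL(1)[OF ps]] psum_mult_right)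
    also have "\<dots> = D q (\<lambda>x z. X ps p x z y)"
      unfolding X_def by (rule psum_swap)
    finally show "(\<Sum>ks\<leftarrow>iter_sweedler H n q. G (map2 actA ks (map fst ps)) (actV p \<circ> W ps \<circ> actV (S y))) =
        D q (\<lambda>x z. X ps p x z y)" .
  qed
  also have "\<dots> = (\<Sum>ps\<leftarrow>PL bs. D h (\<lambda>p r. D r (\<lambda>q y. D q (\<lambda>x z. X ps p x z y))))"
    by (simp only: psum_sum_list_swap)
  also have "\<dots> = (\<Sum>ps\<leftarrow>PL bs. D h (\<lambda>h0 h1. D h0 (\<lambda>p x. D h1 (\<lambda>z y. X ps p x z y))))"
  proof (rule sum_list_cong)
    fix ps assume ps: "ps \<in> set (PL bs)"
    have "D h (\<lambda>p r. D r (\<lambda>q y. D q (\<lambda>x z. X ps p x z y))) =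
        D h (\<lambda>p r. D r (\<lambda>x r'. D r' (\<lambda>z y. X ps p x z y)))"
      by (rule psum_cong, rule coassoc_psum[where q = "(*)"]) (intro X_lin ps lin_intros)+
    also have "\<dots> = D h (\<lambda>h0 h1. D h0 (\<lambda>p x. D h1 (\<lambda>z y. X ps p x z y)))"
      by (rule coassoc_psum[where q = "(*)", symmetric]) (intro X_lin ps lin_intros)+
    finally show "D h (\<lambda>p r. D r (\<lambda>q y. D q (\<lambda>x z. X ps p x z y))) =
        D h (\<lambda>h0 h1. D h0 (\<lambda>p x. D h1 (\<lambda>z y. X ps p x z y)))" .
  qed
  also have "\<dots> = D h (\<lambda>h0 h1. \<Sum>ps\<leftarrow>PL bs. D h0 (\<lambda>p x. D h1 (\<lambda>z y. X ps p x z y)))"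
    by (rule psum_sum_list_swap[symmetric])
  also have "\<dots> = D h (\<lambda>h0 h1. \<Sum>ps\<leftarrow>PL bs. Phi f (S h1 * g * h0) ps)"
    unfolding X_def Phi_def
    by (rule psum_cong, rule sum_list_cong, rule comult_conj_psum[symmetric])
      (intro lin_rules cochain_lin[OF ml] PL | assumption)+
  finally show ?thesis by (simp only: Psi_eq[OF bs])
qed

lemma Psi_cochains: "f \<in> cochains H M n \<Longrightarrow> PSI n f \<in> cochains H N n"
  using Psi_multilinear[of n f] Psi_equivariant[of f n] by (simp add: cochains_def psum_def)

text \<open>On the side of A \<otimes> End(V), acting with S^{-1}(g_0) conjugates the last
  endomorphism. Its left leg cancels a leg of g brought round by the trace, and its right leg
  becomes S(J y) = y. Both sides then agree with one expression in three legs of g.\<close>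

lemma Psi_cyclic_op:
  assumes f: "multilinear_cochain H M n f"
  shows "PSI n (cyclic_op H M n f) = cyclic_op H N n (PSI n f)"
proof (intro ext)
  fix bs g
  show "PSI n (cyclic_op H M n f) bs g = cyclic_op H N n (PSI n f) bs g"
  proof (cases "bs \<in> tuples N (n + 1)")
    case False
    then show ?thesis by (simp add: Psi_def cyclic_op_def)
  next
    case True
    then have "length bs = Suc n" and "set bs \<subseteq> car N" by (auto simp: tuples_def)
    then obtain cs b where bs: "bs = cs @ [b]" and l: "length cs = n" and b: "b \<in> car N"
      and cs: "set cs \<subseteq> car N"
      by (cases bs rule: rev_cases) auto
    have PL: "length (map fst ps) = n" "W ps \<in> Es" if "ps \<in> set (PL cs)" for ps
      using product_lists_twist[OF cs that] l W_endos by auto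
    \<comment> \<open>The common normal form; slot \<open>m\<close> holds the product to be
      collapsed to 1, and \<open>z\<close> is the argument of the cochain.\<close>
    define Y where "Y q m y z = psum (twist b) (\<lambda>a w. \<Sum>ps\<leftarrow>PL cs.
        f (actA q a # map fst ps) z * tr (actV m \<circ> w \<circ> actV y \<circ> W ps))" for q m y z
    have f1: "lin_on C s (*) (\<lambda>x. f (T x # map fst ps) z)"
      if "lin_on C s scaleA T" "ps \<in> set (PL cs)" for C s ps z and T :: "'c::plus \<Rightarrow> 'a"
      using lin_comp[OF cochain_slot[OF f, of "[]" "map fst ps"] that(1)] PL[OF that(2)] by simp
    have f2: "lin_on C s (*) (\<lambda>x. f (a # map fst ps) (T x))"
      if "lin_on C s hs T" "ps \<in> set (PL cs)" for C s ps a and T :: "'c::plus \<Rightarrow> 'h"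
      using lin_comp[OF cochain_lin[OF f] that(1), of "a # map fst ps"] PL[OF that(2)] by simp
    have Y_lin: "lin_on C s (*) (\<lambda>t. Y (T t) m y z)" "lin_on C s (*) (\<lambda>t. Y q (T t) y z)"
      "lin_on C s (*) (\<lambda>t. Y q m (T t) z)" "lin_on C s (*) (\<lambda>t. Y q m y (T t))"
      if "lin_on C s hs T" for C s and T :: "'c::plus \<Rightarrow> 'h" and q m y z
      unfolding Y_def by (intro lin_rules f1 f2 that PL(2) | erule twist_endos[OF b] | assumption)+
    have tup: "act N h b # cs \<in> tuples N (n + 1)" for h
      using l cs act_N_car[OF b] by (simp add: tuples_def)
    have bil: "bilinear (\<lambda>a w. \<Sum>ps\<leftarrow>PL cs. Phi f z ((a, w) # ps))" for z
      using multilinear_form_slot[OF multilinear_form_Phi[OF f], of "[]" cs] cs l by simp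
    have step: "PSI n f (act N h b # cs) z = D h (\<lambda>p r. D r (\<lambda>q y. D z (\<lambda>x z. Y q (x * p) (S y) z)))" for h z
    proof -
      have "PSI n f (act N h b # cs) z = D h (\<lambda>p r. D r (\<lambda>q y.
          psum (twist b) (\<lambda>a w. \<Sum>ps\<leftarrow>PL cs. Phi f z ((actA q a, actV p \<circ> w \<circ> actV (S y)) # ps))))"
        using Psi_slot[of "[]" "act N h b" cs n f z] tup[of h] psum_twist_act[OF bil b] by simp
      also have "\<dots> = D h (\<lambda>p r. D r (\<lambda>q y. psum (twist b) (\<lambda>a w. \<Sum>ps\<leftarrow>PL cs.
          D z (\<lambda>x z. f (actA q a # map fst ps) z * tr (actV (x * p) \<circ> w \<circ> actV (S y) \<circ> W ps)))))"
      proof (intro psum_cong sum_list_cong)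
        fix p r q y a w ps assume "(a, w) \<in> set (twist b)" "ps \<in> set (PL cs)"
        then have "w \<in> Es" "W ps \<in> Es" using twist_endos[OF b] PL by auto
        then have "tr (actV p \<circ> w \<circ> actV (S y) \<circ> W ps \<circ> actV x) = tr (actV (x * p) \<circ> w \<circ> actV (S y) \<circ> W ps)" for x
          using trace_cycle[of "actV p \<circ> w \<circ> actV (S y) \<circ> W ps" "actV x"]
          by (simp add: endos_intros actV_mult comp_assoc)
        then show "Phi f z ((actA q a, actV p \<circ> w \<circ> actV (S y)) # ps) =
            D z (\<lambda>x z. f (actA q a # map fst ps) z * tr (actV (x * p) \<circ> w \<circ> actV (S y) \<circ> W ps))"
          by (simp add: Phi_def comp_assoc)
      qed
      finally show ?thesis
        unfolding Y_def by (simp only: psum_sum_list_swap[symmetric] psum_swap[of "twist b"])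
    qed
    have "cyclic_op H N n (PSI n f) bs g = D g (\<lambda>g0 g1. PSI n f (act N (J g0) b # cs) g1)"
      using True by (simp add: cyclic_op_def psum_def bs l nth_append)
    also have "\<dots> = D g (\<lambda>g0 g1. D (J g0) (\<lambda>p r. D r (\<lambda>q y. D g1 (\<lambda>x z. Y q (x * p) (S y) z))))"
      unfolding step ..
    \<comment> \<open>Reversal by S^{-1} makes \<open>p\<close> the last leg of g_0, hence the
      neighbour of the first leg \<open>x\<close> of g_1, as the collapse of x * J p
      requires.\<close>
    also have "\<dots> = D g (\<lambda>g0 g1. D g0 (\<lambda>r p. D (J r) (\<lambda>q y. D g1 (\<lambda>x z. Y q (x * J p) (S y) z))))"
      by (rule psum_cong, rule comult_J_psum) (intro Y_lin lin_rules)+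
    also have "\<dots> = D g (\<lambda>g0 g1. D g0 (\<lambda>r p. D r (\<lambda>y q. D g1 (\<lambda>x z. Y (J q) (x * J p) (S (J y)) z))))"
      by (rule psum_cong, rule psum_cong, rule comult_J_psum) (intro Y_lin lin_rules)+
    also have "\<dots> = D g (\<lambda>g0 g1. D g0 (\<lambda>r p. D r (\<lambda>y q. D g1 (\<lambda>x z. Y (J q) (x * J p) y z))))"
      by simp
    also have "\<dots> = D g (\<lambda>g0 g1. D g0 (\<lambda>y k. D k (\<lambda>q p. D g1 (\<lambda>x z. Y (J q) (x * J p) y z))))"
      by (rule psum_cong, rule coassoc_psum[where q = "(*)"]) (intro Y_lin lin_rules)+
    also have "\<dots> = D g (\<lambda>y l. D l (\<lambda>k g1. D k (\<lambda>q p. D g1 (\<lambda>x z. Y (J q) (x * J p) y z))))"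
      by (rule coassoc_psum[where q = "(*)"]) (intro Y_lin lin_rules)+
    also have "\<dots> = D g (\<lambda>y l. D l (\<lambda>q m. D m (\<lambda>p g1. D g1 (\<lambda>x z. Y (J q) (x * J p) y z))))"
      by (rule psum_cong, rule coassoc_psum[where q = "(*)"]) (intro Y_lin lin_rules)+
    also have "\<dots> = D g (\<lambda>y l. D l (\<lambda>q z. Y (J q) 1 y z))"
      by (rule psum_cong, rule psum_cong, rule collapse_left[OF J_right_psum, where q = "(*)"])
        (intro Y_lin lin_rules)+
    finally have rhs: "cyclic_op H N n (PSI n f) bs g = D g (\<lambda>y l. D l (\<lambda>q z. Y (J q) 1 y z))" .
    have "PSI n (cyclic_op H M n f) bs g =
        psum (twist b) (\<lambda>a w. \<Sum>ps\<leftarrow>PL cs. Phi (cyclic_op H M n f) g (ps @ [(a, w)]))"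
      using Psi_slot[of cs b "[]" n] True by (simp add: bs)
    also have "\<dots> = psum (twist b) (\<lambda>a w. \<Sum>ps\<leftarrow>PL cs. D g (\<lambda>y l. D l (\<lambda>q z.
        f (actA (J q) a # map fst ps) z * tr (actV 1 \<circ> w \<circ> actV y \<circ> W ps))))"
    proof (intro psum_cong sum_list_cong)
      fix a w ps assume "(a, w) \<in> set (twist b)" and ps: "ps \<in> set (PL cs)"
      then have "w \<in> Es" "W ps \<in> Es" using twist_endos[OF b] PL by auto
      \<comment> \<open>The factor \<open>actV 1\<close> is inserted to match the collapsed slot
        \<open>m\<close> of \<open>Y\<close>.\<close>
      then have tr: "tr (W (ps @ [(a, w)]) \<circ> actV y) = tr (actV 1 \<circ> w \<circ> actV y \<circ> W ps)" for y
        using trace_cycle[of "W ps" "w \<circ> actV y"] W_append[of ps "[(a, w)]"]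
        by (simp add: endos_intros actV_one comp_assoc)
      have "cyclic_op H M n f (map fst (ps @ [(a, w)])) z = D z (\<lambda>q z. f (actA (J q) a # map fst ps) z)" for z
        using PL[OF ps] by (simp add: cyclic_op_def tuples_def type_alg_def psum_def nth_append)
      then show "Phi (cyclic_op H M n f) g (ps @ [(a, w)]) = D g (\<lambda>y l. D l (\<lambda>q z.
          f (actA (J q) a # map fst ps) z * tr (actV 1 \<circ> w \<circ> actV y \<circ> W ps)))"
        unfolding Phi_def tr by (simp only: psum_mult_right)
    qed
    also have "\<dots> = D g (\<lambda>y l. D l (\<lambda>q z. Y (J q) 1 y z))"
      unfolding Y_def by (simp only: psum_sum_list_swap[symmetric] psum_swap[of "twist b"])
    finally show ?thesis using rhs by simp
  qed
qed

text \<open>After the twist, multiplying two neighbouring factors multiplies both components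
  separately. The A-parts give the coface of f, and the composite of all endomorphisms is unchanged
  by associativity.\<close>

lemma Psi_coface_less:
  assumes f: "multilinear_cochain H M n f" and i: "i \<le> n"
  shows "PSI (Suc n) (coface H M (Suc n) i f) = coface H N (Suc n) i (PSI n f)"
proof (intro ext)
  fix bs g
  show "PSI (Suc n) (coface H M (Suc n) i f) bs g = coface H N (Suc n) i (PSI n f) bs g"
  proof (cases "bs \<in> tuples N (Suc n + 1)")
    case False
    then show ?thesis by (simp add: Psi_def coface_def)
  next
    case True
    define cs b b' ds where "cs = take i bs" and "b = bs ! i" and "b' = bs ! Suc i"
      and "ds = drop (Suc (Suc i)) bs"
    have l: "length bs = Suc (Suc n)" and car: "set bs \<subseteq> car N" using True by (auto simp: tuples_def)
    have "bs = take i bs @ bs ! i # drop (Suc i) bs"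
      using l i by (intro id_take_nth_drop) simp
    moreover have "drop (Suc i) bs = bs ! Suc i # drop (Suc (Suc i)) bs"
      using l i by (intro Cons_nth_drop_Suc[symmetric]) simp
    ultimately have bs: "bs = cs @ b # b' # ds"
      unfolding cs_def b_def b'_def ds_def by argo
    have cs: "set cs \<subseteq> car N" "length cs = i" and b: "b \<in> car N" and b': "b' \<in> car N"
      and ds: "set ds \<subseteq> car N" "i + length ds = n"
      using car[unfolded bs] l i by (auto simp: cs_def ds_def)
    have bil: "bilinear (\<lambda>a w. \<Sum>ps\<leftarrow>PL cs. \<Sum>qs\<leftarrow>PL ds. Phi f g (ps @ (a, w) # qs))"
      using cs ds by (intro multilinear_form_slot[OF multilinear_form_Phi[OF f]]) auto
    have tup: "cs @ mul N b b' # ds \<in> tuples N (n + 1)"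
      using cs ds mul_N_car[OF b b'] by (simp add: tuples_def)
    have "PSI (Suc n) (coface H M (Suc n) i f) bs g =
        psum (twist b) (\<lambda>a w. \<Sum>ps\<leftarrow>PL cs. \<Sum>qs\<leftarrow>PL (b' # ds).
          Phi (coface H M (Suc n) i f) g (ps @ (a, w) # qs))"
      using Psi_slot[of cs b "b' # ds" "Suc n"] True by (simp add: bs del: product_lists.simps)
    also have "\<dots> = psum (twist b) (\<lambda>a w. psum (twist b') (\<lambda>a' w'. \<Sum>ps\<leftarrow>PL cs. \<Sum>qs\<leftarrow>PL ds.
          Phi (coface H M (Suc n) i f) g (ps @ (a, w) # (a', w') # qs)))"
      by (simp add: sum_product_lists_Cons psum_sum_list_swap del: product_lists.simps)
    also have "\<dots> = psum (twist b) (\<lambda>a w. psum (twist b') (\<lambda>a' w'. \<Sum>ps\<leftarrow>PL cs. \<Sum>qs\<leftarrow>PL ds.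
          Phi f g (ps @ (a * a', w \<circ> w') # qs)))"
    proof (intro psum_cong sum_list_cong)
      fix a w a' w' ps qs assume "ps \<in> set (PL cs)" "qs \<in> set (PL ds)"
      then have "length ps = i" "i + length qs = n"
        using product_lists_twist(1)[of cs ps] product_lists_twist(1)[of ds qs] cs ds by auto
      then show "Phi (coface H M (Suc n) i f) g (ps @ (a, w) # (a', w') # qs) =
          Phi f g (ps @ (a * a', w \<circ> w') # qs)"
        by (simp add: Phi_def coface_def tuples_def type_alg_def nth_append comp_assoc)
    qed
    also have "\<dots> = psum (twist (mul N b b')) (\<lambda>a w. \<Sum>ps\<leftarrow>PL cs. \<Sum>qs\<leftarrow>PL ds.
          Phi f g (ps @ (a, w) # qs))"
      by (rule psum_twist_mul[OF bil b b', symmetric])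
    also have "\<dots> = PSI n f (cs @ mul N b b' # ds) g"
      by (rule Psi_slot[OF tup, symmetric])
    also have "\<dots> = coface H N (Suc n) i (PSI n f) bs g"
      using True i by (simp add: coface_def cs_def b_def b'_def ds_def)
    finally show ?thesis .
  qed
qed

text \<open>Supplies the hypothesis of \<open>Psi_cyclic_op\<close> for the zeroth coface of f, from
  which the last coface is obtained.\<close>

lemma coface_0_multilinear:
  assumes f: "multilinear_cochain H M n f"
  shows "multilinear_cochain H M (Suc n) (coface H M (Suc n) 0 f)"
proof -
  have cf: "coface H M (Suc n) 0 f (a # b # as) g = f (a * b # as) g" if "length as = n" for a b as g
    using that by (simp add: coface_def tuples_def type_alg_def)
  have slot: "lin_on UNIV scaleA (*) (\<lambda>x. coface H M (Suc n) 0 f (as[i := x]) g)"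
    if as: "length as = Suc (Suc n)" and "i \<le> Suc n" for as i g
  proof -
    obtain a b cs where as': "as = a # b # cs" and l: "length cs = n"
      using as by (auto simp: length_Suc_conv)
    note s0 = lin_comp[OF cochain_slot[OF f, of "[]" cs, simplified, OF l]]
    \<comment> \<open>Positions 0 and 1 are the two factors of the product; a later position is an
      untouched argument, moved one place forward.\<close>
    consider "i = 0" | "i = 1" | j where "i = Suc (Suc j)" "j < n"
      using \<open>i \<le> Suc n\<close> by (metis Suc_le_lessD Suc_le_mono One_nat_def nat.exhaust)
    then show ?thesis
    proof cases
      case 1
      show ?thesis unfolding as' 1 using l by (simp add: cf) (intro s0 lin_rules)
    next
      case 2
      show ?thesis unfolding as' 2 using l by (simp add: cf) (intro s0 lin_rules)
    next
      case 3
      have "lin_on UNIV scaleA (*) (\<lambda>x. f ((a * b # take j cs) @ x # drop (Suc j) cs) g)"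
        using l 3 by (intro cochain_slot[OF f]) simp
      then show ?thesis
        using l 3 by (simp add: as' cf upd_conv_take_nth_drop)
    qed
  qed
  have lin: "Vector_Spaces.linear hs (*) (coface H M (Suc n) 0 f as)" if as: "length as = Suc (Suc n)" for as
  proof -
    obtain a b cs where as': "as = a # b # cs" and l: "length cs = n"
      using as by (auto simp: length_Suc_conv)
    have "coface H M (Suc n) 0 f as = f (a * b # cs)" using l by (simp add: as' cf fun_eq_iff)
    moreover have "lin_on UNIV hs (*) (f (a * b # cs))" using l by (intro cochain_lin[OF f]) simp
    ultimately show ?thesis by (simp add: lin_linear[OF vector_space_hs vector_space_field])
  qed
  show ?thesis
    unfolding multilinear_cochain_def
    using slot lin
    by (auto simp: tuples_def type_alg_def lin_on_def coface_def fun_eq_iff)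
qed

lemma Psi_coface:
  assumes f: "multilinear_cochain H M n f" and i: "i \<le> Suc n"
  shows "PSI (Suc n) (coface H M (Suc n) i f) = coface H N (Suc n) i (PSI n f)"
proof (cases "i = Suc n")
  case True
  then show ?thesis
    using Psi_cyclic_op[OF coface_0_multilinear[OF f]] Psi_coface_less[OF f, of 0]
    by (simp add: coface_last act_N_car type_alg_def)
next
  case False
  then show ?thesis using Psi_coface_less[OF f] i by simp
qed

text \<open>The twist fixes the unit, so the inserted factor contributes 1 to the arguments of f and
  the identity to the trace.\<close>

lemma Psi_codegeneracy:
  assumes f: "multilinear_cochain H M (Suc n) f" and i: "i \<le> n"
  shows "PSI n (codegeneracy M n i f) = codegeneracy N n i (PSI (Suc n) f)"
proof (intro ext)
  fix bs g
  show "PSI n (codegeneracy M n i f) bs g = codegeneracy N n i (PSI (Suc n) f) bs g"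
  proof (cases "bs \<in> tuples N (n + 1)")
    case False
    then show ?thesis by (simp add: Psi_def codegeneracy_def)
  next
    case True
    \<comment> \<open>The cut is at \<open>Suc i\<close> because the unit goes after the entry with
      index i.\<close>
    define cs ds where "cs = take (Suc i) bs" and "ds = drop (Suc i) bs"
    have l: "length bs = Suc n" and car: "set bs \<subseteq> car N" using True by (auto simp: tuples_def)
    have bs: "bs = cs @ ds" by (simp add: cs_def ds_def)
    have cs: "set cs \<subseteq> car N" "length cs = Suc i" and ds: "set ds \<subseteq> car N" "i + length ds = n"
      using car l i by (auto simp: cs_def ds_def dest: in_set_takeD in_set_dropD)
    have bil: "bilinear (\<lambda>a w. \<Sum>ps\<leftarrow>PL cs. \<Sum>qs\<leftarrow>PL ds. Phi f g (ps @ (a, w) # qs))"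
      using cs ds by (intro multilinear_form_slot[OF multilinear_form_Phi[OF f]]) auto
    have tup: "cs @ unt N # ds \<in> tuples N (Suc n + 1)"
      using cs ds unt_N_car by (simp add: tuples_def)
    have "codegeneracy N n i (PSI (Suc n) f) bs g = PSI (Suc n) f (cs @ unt N # ds) g"
      using True by (simp add: codegeneracy_def cs_def ds_def)
    also have "\<dots> = (\<Sum>ps\<leftarrow>PL cs. \<Sum>qs\<leftarrow>PL ds. Phi f g (ps @ (1, id) # qs))"
      unfolding Psi_slot[OF tup] by (rule psum_twist_unt[OF bil])
    also have "\<dots> = (\<Sum>ps\<leftarrow>PL cs. \<Sum>qs\<leftarrow>PL ds. Phi (codegeneracy M n i f) g (ps @ qs))"
    proof (intro sum_list_cong)
      fix ps qs assume "ps \<in> set (PL cs)" "qs \<in> set (PL ds)"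
      then have "length ps = Suc i" "i + length qs = n"
        using product_lists_twist(1)[of cs ps] product_lists_twist(1)[of ds qs] cs ds by auto
      then show "Phi f g (ps @ (1, id) # qs) = Phi (codegeneracy M n i f) g (ps @ qs)"
        by (simp add: Phi_def codegeneracy_def tuples_def type_alg_def)
    qed
    also have "\<dots> = PSI n (codegeneracy M n i f) bs g"
      unfolding Psi_eq[OF True] by (simp add: bs sum_product_lists_append)
    finally show ?thesis by simp
  qed
qed

section \<open>Linearity in the cochain and assembly of the morphism\<close>

lemma Phi_add: "Phi (\<lambda>as g. f as g + f' as g) g ps = Phi f g ps + Phi f' g ps"
  by (simp add: Phi_def distrib_right psum_add)

lemma Phi_scale: "Phi (\<lambda>as g. c * f as g) g ps = c * Phi f g ps"
  by (simp add: Phi_def psum_mult_left mult.assoc)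

lemma Psi_add: "PSI n (\<lambda>as g. f as g + f' as g) bs g = PSI n f bs g + PSI n f' bs g"
  by (cases "bs \<in> tuples N (n + 1)") (simp_all add: Psi_eq Phi_add sum_list_addf, simp add: Psi_def)

lemma Psi_scale: "PSI n (\<lambda>as g. c * f as g) bs g = c * PSI n f bs g"
  by (cases "bs \<in> tuples N (n + 1)") (simp_all add: Psi_eq Phi_scale sum_list_const_mult, simp add: Psi_def)

lemma Psi_cocyclic_morphism: "cocyclic_morphism H M N PSI"
proof -
  have ml: "multilinear_cochain H M n f" if "f \<in> cochains H M n" for n f
    using that by (simp add: cochains_def)
  show ?thesis
    unfolding cocyclic_morphism_def
  proof (intro conjI allI ballI impI)
    fix n i f assume "1 \<le> n" "i \<le> n" "f \<in> cochains H M (n - 1)"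
    then show "PSI n (coface H M n i f) = coface H N n i (PSI (n - 1) f)"
      using Psi_coface[OF ml, of f "n - 1" i] by simp
  next
    fix n i f assume "i \<le> n" "f \<in> cochains H M (n + 1)"
    then show "PSI n (codegeneracy M n i f) = codegeneracy N n i (PSI (n + 1) f)"
      using Psi_codegeneracy[of n f i] ml by simp
  qed (simp_all only: Psi_cochains Psi_add Psi_scale Psi_cyclic_op[OF ml])
qed

end

theorem proposition5p2:
  fixes H :: "('k::field_char_0, 'h::{ring, monoid_mult}) hopf_data"
    and scaleA :: "'k \<Rightarrow> 'a::{ring, monoid_mult} \<Rightarrow> 'a"
    and actA :: "'h \<Rightarrow> 'a \<Rightarrow> 'a"
    and coact :: "'a \<Rightarrow> ('a \<times> 'h) list set"
    and scaleV :: "'k \<Rightarrow> 'v::ab_group_add \<Rightarrow> 'v"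
    and actV :: "'h \<Rightarrow> 'v \<Rightarrow> 'v"
  assumes "hopf_algebra H"
    and "bij (antipode H)"
    and "yetter_drinfeld_algebra H scaleA actA coact"
    and "hopf_module H scaleV actV"
    and "finite_dim scaleV"
  shows "(\<forall>n. \<forall>f\<in>cochains H (type_alg scaleA actA) n. \<forall>aus g.
            length aus = n + 1 \<longrightarrow> (\<forall>(a, u)\<in>set aus. u \<in> endos scaleV) \<longrightarrow>
            Psi H scaleA actA coact scaleV actV n f
              (map (\<lambda>(a, u). end_class scaleA scaleV [(a, u)]) aus) g =
            Psi_pure H coact scaleV actV f aus g)
       \<and> cocyclic_morphism H (type_alg scaleA actA) (end_alg H scaleA actA coact scaleV actV)
            (Psi H scaleA actA coact scaleV actV)"
proof -
  interpret yetter_drinfeld_setting H scaleA actA coact scaleV actV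
    using assms
    by (intro yetter_drinfeld_setting.intro bijective_hopf_algebra.intro
        bijective_hopf_algebra_axioms.intro yetter_drinfeld_setting_axioms.intro)
  show ?thesis
    using Psi_class Psi_cocyclic_morphism by (auto simp: cochains_def)
qed

end
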